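(* Let $\mathbb{X}$ be an additive linear category with monoidal coalgebra modality $(!,\delta,\varepsilon,m_\otimes,m_K,\Delta,e)$, and let $\nabla:=(\delta\otimes\delta)m_\otimes!(\varepsilon\otimes e+e\otimes\varepsilon)$ and $u:=m_K!(0)$ be the multiplication and unit of the induced additive bialgebra modality. Let $\mathsf{d}:{!A}\otimes A\to{!A}$ be a natural transformation which satisfies the linear rule $\mathsf{d}\varepsilon=e\otimes1$ and the chain rule $\mathsf{d}\delta=(\Delta\otimes1)(\delta\otimes\mathsf{d})\mathsf{d}$ (the last $\mathsf{d}$ being the component at ${!A}$). Then the following are equivalent: (i) $\mathsf{d}$ satisfies the Leibniz rule $\mathsf{d}\Delta=(\Delta\otimes1)\big((1\otimes\mathsf{d})+(1\otimes\sigma)(\mathsf{d}\otimes1)\big)$; (ii) $\mathsf{d}$ satisfies the $\nabla$-rule $(\nabla\otimes1)\mathsf{d}=(1\otimes\mathsf{d})\nabla$; (iii) $\mathsf{d}$ satisfies the monoidal rule $(1\otimes\mathsf{d})m_\otimes=(\Delta\otimes1\otimes1)(1\otimes\sigma\otimes1)(m_\otimes\otimes\varepsilon\otimes1)\mathsf{d}$ as maps ${!A}\otimes{!B}\otimes B\to{!(A\otimes B)}$.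
   Context: Composition is in diagrammatic order ($fg$ means first $f$, then $g$). Symmetric monoidal categories are treated as strict (associators and unitors suppressed), with tensor $\otimes$, unit $K$, symmetry $\sigma:A\otimes B\to B\otimes A$. An additive symmetric monoidal category is a symmetric monoidal category enriched in commutative monoids (hom-sets have $+$ and $0$, no negatives, no biproducts assumed), with composition and $\otimes$ preserving $+$ and $0$ in each variable. A coalgebra modality $(!,\delta,\varepsilon,\Delta,e)$ is a comonad $(!,\delta,\varepsilon)$, $\delta:{!A}\to{!!A}$, $\varepsilon:{!A}\to A$, with natural transformations $\Delta:{!A}\to{!A}\otimes{!A}$, $e:{!A}\to K$ such that each $({!A},\Delta,e)$ is a cocommutative comonoid and $\delta\Delta=\Delta(\delta\otimes\delta)$. A monoidal coalgebra modality $(!,\delta,\varepsilon,m_\otimes,m_K,\Delta,e)$ is a coalgebra modality with a natural transformation $m_\otimes:{!A}\otimes{!B}\to{!(A\otimes B)}$ and a map $m_K:K\to{!K}$ such that: $(!,m_\otimes,m_K)$ is a (lax) symmetric monoidal endofunctor; $\delta,\varepsilon$ are monoidal: $m_\otimes\delta=(\delta\otimes\delta)m_\otimes!(m_\otimes)$, $m_K\delta=m_K!(m_K)$, $m_\otimes\varepsilon=\varepsilon\otimes\varepsilon$, $m_K\varepsilon=1$; $\Delta,e$ are monoidal: $m_\otimes\Delta=(\Delta\otimes\Delta)(1\otimes\sigma\otimes1)(m_\otimes\otimes m_\otimes)$, $m_\otimes e=e\otimes e$, $m_K\Delta=m_K\otimes m_K$, $m_Ke=1$; and $\Delta,e$ are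 $!$-coalgebra morphisms: $\delta\,!(\Delta)=\Delta(\delta\otimes\delta)m_\otimes$, $\delta\,!(e)=e\,m_K$. An additive linear category is an additive symmetric monoidal category equipped with a monoidal coalgebra modality. *)

theory Defs
  imports Main
begin

text \<open>Composition \<open>f \<Zsemi> g\<close> is in diagrammatic order, and monoidal categories are strict.\<close>

record ('o, 'a) category =
  Obj :: "'o set"
  Arr :: "'a set"
  Dom :: "'a \<Rightarrow> 'o"
  Cod :: "'a \<Rightarrow> 'o"
  ident :: "'o \<Rightarrow> 'a" ("\<one>\<index>")
  comp :: "'a \<Rightarrow> 'a \<Rightarrow> 'a" (infixl "\<Zsemi>\<index>" 65)

definition hom :: "('o, 'a, 'x) category_scheme \<Rightarrow> 'o \<Rightarrow> 'o \<Rightarrow> 'a set" where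
  "hom X A B = {f \<in> Arr X. Dom X f = A \<and> Cod X f = B}"

locale category =
  fixes X :: "('o, 'a, 'x) category_scheme" (structure)
  assumes Dom_closed: "f \<in> Arr X \<Longrightarrow> Dom X f \<in> Obj X"
    and Cod_closed: "f \<in> Arr X \<Longrightarrow> Cod X f \<in> Obj X"
    and ident_hom: "A \<in> Obj X \<Longrightarrow> \<one> A \<in> hom X A A"
    and comp_hom: "\<lbrakk>f \<in> hom X A B; g \<in> hom X B C\<rbrakk> \<Longrightarrow> f \<Zsemi> g \<in> hom X A C"
    and ident_left: "f \<in> hom X A B \<Longrightarrow> \<one> A \<Zsemi> f = f"
    and ident_right: "f \<in> hom X A B \<Longrightarrow> f \<Zsemi> \<one> B = f"
    and comp_assoc: "\<lbrakk>f \<in> hom X A B; g \<in> hom X B C; h \<in> hom X C D\<rbrakk>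
      \<Longrightarrow> (f \<Zsemi> g) \<Zsemi> h = f \<Zsemi> (g \<Zsemi> h)"

record ('o, 'a) symmetric_monoidal_category = "('o, 'a) category" +
  tensor_obj :: "'o \<Rightarrow> 'o \<Rightarrow> 'o" (infixr "\<odot>\<index>" 70)
  tensor :: "'a \<Rightarrow> 'a \<Rightarrow> 'a" (infixr "\<otimes>\<index>" 70)
  unit_obj :: "'o" ("\<K>\<index>")
  symm :: "'o \<Rightarrow> 'o \<Rightarrow> 'a" ("\<sigma>\<index>")

locale symmetric_monoidal_category = category X
  for X :: "('o, 'a, 'x) symmetric_monoidal_category_scheme" (structure) +
  assumes tensor_obj_closed: "\<lbrakk>A \<in> Obj X; B \<in> Obj X\<rbrakk> \<Longrightarrow> A \<odot> B \<in> Obj X"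
    and unit_obj_closed: "\<K> \<in> Obj X"
    and tensor_hom: "\<lbrakk>f \<in> hom X A B; g \<in> hom X C D\<rbrakk> \<Longrightarrow> f \<otimes> g \<in> hom X (A \<odot> C) (B \<odot> D)"
    and tensor_ident: "\<lbrakk>A \<in> Obj X; B \<in> Obj X\<rbrakk> \<Longrightarrow> \<one> A \<otimes> \<one> B = \<one> (A \<odot> B)"
    and tensor_comp: "\<lbrakk>f \<in> hom X A B; g \<in> hom X B C; h \<in> hom X A' B'; k \<in> hom X B' C'\<rbrakk>
      \<Longrightarrow> (f \<Zsemi> g) \<otimes> (h \<Zsemi> k) = (f \<otimes> h) \<Zsemi> (g \<otimes> k)"
    and tensor_obj_assoc: "\<lbrakk>A \<in> Obj X; B \<in> Obj X; C \<in> Obj X\<rbrakk> \<Longrightarrow> (A \<odot> B) \<odot> C = A \<odot> (B \<odot> C)"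
    and tensor_obj_unit_left: "A \<in> Obj X \<Longrightarrow> \<K> \<odot> A = A"
    and tensor_obj_unit_right: "A \<in> Obj X \<Longrightarrow> A \<odot> \<K> = A"
    and tensor_assoc: "\<lbrakk>f \<in> Arr X; g \<in> Arr X; h \<in> Arr X\<rbrakk> \<Longrightarrow> (f \<otimes> g) \<otimes> h = f \<otimes> (g \<otimes> h)"
    and tensor_unit_left: "f \<in> Arr X \<Longrightarrow> \<one> \<K> \<otimes> f = f"
    and tensor_unit_right: "f \<in> Arr X \<Longrightarrow> f \<otimes> \<one> \<K> = f"
    and symm_hom: "\<lbrakk>A \<in> Obj X; B \<in> Obj X\<rbrakk> \<Longrightarrow> \<sigma> A B \<in> hom X (A \<odot> B) (B \<odot> A)"
    and symm_natural: "\<lbrakk>f \<in> hom X A A'; g \<in> hom X B B'\<rbrakk>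
      \<Longrightarrow> (f \<otimes> g) \<Zsemi> \<sigma> A' B' = \<sigma> A B \<Zsemi> (g \<otimes> f)"
    and symm_symm: "\<lbrakk>A \<in> Obj X; B \<in> Obj X\<rbrakk> \<Longrightarrow> \<sigma> A B \<Zsemi> \<sigma> B A = \<one> (A \<odot> B)"
    and symm_unit: "A \<in> Obj X \<Longrightarrow> \<sigma> A \<K> = \<one> A"
    and symm_hexagon: "\<lbrakk>A \<in> Obj X; B \<in> Obj X; C \<in> Obj X\<rbrakk>
      \<Longrightarrow> \<sigma> A (B \<odot> C) = (\<sigma> A B \<otimes> \<one> C) \<Zsemi> (\<one> B \<otimes> \<sigma> A C)"

record ('o, 'a) additive_symmetric_monoidal_category =
  "('o, 'a) symmetric_monoidal_category" +
  add :: "'a \<Rightarrow> 'a \<Rightarrow> 'a" (infixl "\<oplus>\<index>" 60)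
  zero :: "'o \<Rightarrow> 'o \<Rightarrow> 'a" ("\<zero>\<index>")

locale additive_symmetric_monoidal_category = symmetric_monoidal_category X
  for X :: "('o, 'a, 'x) additive_symmetric_monoidal_category_scheme" (structure) +
  assumes add_hom: "\<lbrakk>f \<in> hom X A B; g \<in> hom X A B\<rbrakk> \<Longrightarrow> f \<oplus> g \<in> hom X A B"
    and zero_hom: "\<lbrakk>A \<in> Obj X; B \<in> Obj X\<rbrakk> \<Longrightarrow> \<zero> A B \<in> hom X A B"
    and add_assoc: "\<lbrakk>f \<in> hom X A B; g \<in> hom X A B; h \<in> hom X A B\<rbrakk>
      \<Longrightarrow> (f \<oplus> g) \<oplus> h = f \<oplus> (g \<oplus> h)"
    and add_commute: "\<lbrakk>f \<in> hom X A B; g \<in> hom X A B\<rbrakk> \<Longrightarrow> f \<oplus> g = g \<oplus> f"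
    and add_zero: "f \<in> hom X A B \<Longrightarrow> f \<oplus> \<zero> A B = f"
    and comp_add_left: "\<lbrakk>f \<in> hom X A B; g \<in> hom X A B; h \<in> hom X B C\<rbrakk>
      \<Longrightarrow> (f \<oplus> g) \<Zsemi> h = f \<Zsemi> h \<oplus> g \<Zsemi> h"
    and comp_add_right: "\<lbrakk>f \<in> hom X A B; g \<in> hom X B C; h \<in> hom X B C\<rbrakk>
      \<Longrightarrow> f \<Zsemi> (g \<oplus> h) = f \<Zsemi> g \<oplus> f \<Zsemi> h"
    and comp_zero_left: "\<lbrakk>A \<in> Obj X; f \<in> hom X B C\<rbrakk> \<Longrightarrow> \<zero> A B \<Zsemi> f = \<zero> A C"
    and comp_zero_right: "\<lbrakk>f \<in> hom X A B; C \<in> Obj X\<rbrakk> \<Longrightarrow> f \<Zsemi> \<zero> B C = \<zero> A C"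
    and tensor_add_left: "\<lbrakk>f \<in> hom X A B; g \<in> hom X A B; h \<in> hom X C D\<rbrakk>
      \<Longrightarrow> (f \<oplus> g) \<otimes> h = f \<otimes> h \<oplus> g \<otimes> h"
    and tensor_add_right: "\<lbrakk>f \<in> hom X A B; g \<in> hom X C D; h \<in> hom X C D\<rbrakk>
      \<Longrightarrow> f \<otimes> (g \<oplus> h) = f \<otimes> g \<oplus> f \<otimes> h"
    and tensor_zero_left: "\<lbrakk>A \<in> Obj X; B \<in> Obj X; f \<in> hom X C D\<rbrakk>
      \<Longrightarrow> \<zero> A B \<otimes> f = \<zero> (A \<odot> C) (B \<odot> D)"
    and tensor_zero_right: "\<lbrakk>f \<in> hom X A B; C \<in> Obj X; D \<in> Obj X\<rbrakk>
      \<Longrightarrow> f \<otimes> \<zero> C D = \<zero> (A \<odot> C) (B \<odot> D)"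

text \<open>The functor \<open>!\<close> is split into its action on objects, \<open>!\<^sub>o\<close>, and on arrows, \<open>!\<^sub>a\<close>; it is not
  assumed to preserve sums. The comonoid counit \<open>e\<close> is written \<open>\<ee>\<close>, and the
  monoidal structure maps \<open>m\<^sub>\<otimes>\<close>, \<open>m\<^sub>K\<close> are written \<open>\<mm>\<close>, \<open>\<mm>\<^sub>K\<close>.\<close>

record ('o, 'a) additive_linear_category =
  "('o, 'a) additive_symmetric_monoidal_category" +
  bang_obj :: "'o \<Rightarrow> 'o" ("!\<^sub>o\<index>")
  bang :: "'a \<Rightarrow> 'a" ("!\<^sub>a\<index>")
  comult :: "'o \<Rightarrow> 'a" ("\<delta>\<index>")
  counit :: "'o \<Rightarrow> 'a" ("\<epsilon>\<index>")
  copy :: "'o \<Rightarrow> 'a" ("\<Delta>\<index>")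
  discard :: "'o \<Rightarrow> 'a" ("\<ee>\<index>")
  mon_tensor :: "'o \<Rightarrow> 'o \<Rightarrow> 'a" ("\<mm>\<index>")
  mon_unit :: "'a" ("\<mm>\<^sub>K\<index>")

locale coalgebra_modality = symmetric_monoidal_category X
  for X :: "('o, 'a, 'x) additive_linear_category_scheme" (structure) +
  assumes bang_obj_closed: "A \<in> Obj X \<Longrightarrow> !\<^sub>o A \<in> Obj X"
    and bang_hom: "f \<in> hom X A B \<Longrightarrow> !\<^sub>a f \<in> hom X (!\<^sub>o A) (!\<^sub>o B)"
    and bang_ident: "A \<in> Obj X \<Longrightarrow> !\<^sub>a (\<one> A) = \<one> (!\<^sub>o A)"
    and bang_comp: "\<lbrakk>f \<in> hom X A B; g \<in> hom X B C\<rbrakk> \<Longrightarrow> !\<^sub>a (f \<Zsemi> g) = !\<^sub>a f \<Zsemi> !\<^sub>a g"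
    and comult_hom: "A \<in> Obj X \<Longrightarrow> \<delta> A \<in> hom X (!\<^sub>o A) (!\<^sub>o (!\<^sub>o A))"
    and comult_natural: "f \<in> hom X A B \<Longrightarrow> !\<^sub>a f \<Zsemi> \<delta> B = \<delta> A \<Zsemi> !\<^sub>a (!\<^sub>a f)"
    and counit_hom: "A \<in> Obj X \<Longrightarrow> \<epsilon> A \<in> hom X (!\<^sub>o A) A"
    and counit_natural: "f \<in> hom X A B \<Longrightarrow> !\<^sub>a f \<Zsemi> \<epsilon> B = \<epsilon> A \<Zsemi> f"
    and comult_counit: "A \<in> Obj X \<Longrightarrow> \<delta> A \<Zsemi> \<epsilon> (!\<^sub>o A) = \<one> (!\<^sub>o A)"
    and comult_bang_counit: "A \<in> Obj X \<Longrightarrow> \<delta> A \<Zsemi> !\<^sub>a (\<epsilon> A) = \<one> (!\<^sub>o A)"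
    and comult_comult: "A \<in> Obj X \<Longrightarrow> \<delta> A \<Zsemi> \<delta> (!\<^sub>o A) = \<delta> A \<Zsemi> !\<^sub>a (\<delta> A)"
    and copy_hom: "A \<in> Obj X \<Longrightarrow> \<Delta> A \<in> hom X (!\<^sub>o A) (!\<^sub>o A \<odot> !\<^sub>o A)"
    and copy_natural: "f \<in> hom X A B \<Longrightarrow> !\<^sub>a f \<Zsemi> \<Delta> B = \<Delta> A \<Zsemi> (!\<^sub>a f \<otimes> !\<^sub>a f)"
    and discard_hom: "A \<in> Obj X \<Longrightarrow> \<ee> A \<in> hom X (!\<^sub>o A) \<K>"
    and discard_natural: "f \<in> hom X A B \<Longrightarrow> !\<^sub>a f \<Zsemi> \<ee> B = \<ee> A"
    and copy_coassoc: "A \<in> Obj X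
      \<Longrightarrow> \<Delta> A \<Zsemi> (\<Delta> A \<otimes> \<one> (!\<^sub>o A)) = \<Delta> A \<Zsemi> (\<one> (!\<^sub>o A) \<otimes> \<Delta> A)"
    and copy_discard_left: "A \<in> Obj X \<Longrightarrow> \<Delta> A \<Zsemi> (\<ee> A \<otimes> \<one> (!\<^sub>o A)) = \<one> (!\<^sub>o A)"
    and copy_discard_right: "A \<in> Obj X \<Longrightarrow> \<Delta> A \<Zsemi> (\<one> (!\<^sub>o A) \<otimes> \<ee> A) = \<one> (!\<^sub>o A)"
    and copy_symm: "A \<in> Obj X \<Longrightarrow> \<Delta> A \<Zsemi> \<sigma> (!\<^sub>o A) (!\<^sub>o A) = \<Delta> A"
    and comult_copy: "A \<in> Obj X \<Longrightarrow> \<delta> A \<Zsemi> \<Delta> (!\<^sub>o A) = \<Delta> A \<Zsemi> (\<delta> A \<otimes> \<delta> A)"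

locale monoidal_coalgebra_modality = coalgebra_modality X
  for X :: "('o, 'a, 'x) additive_linear_category_scheme" (structure) +
  assumes mon_tensor_hom: "\<lbrakk>A \<in> Obj X; B \<in> Obj X\<rbrakk>
      \<Longrightarrow> \<mm> A B \<in> hom X (!\<^sub>o A \<odot> !\<^sub>o B) (!\<^sub>o (A \<odot> B))"
    and mon_tensor_natural: "\<lbrakk>f \<in> hom X A A'; g \<in> hom X B B'\<rbrakk>
      \<Longrightarrow> (!\<^sub>a f \<otimes> !\<^sub>a g) \<Zsemi> \<mm> A' B' = \<mm> A B \<Zsemi> !\<^sub>a (f \<otimes> g)"
    and mon_unit_hom: "\<mm>\<^sub>K \<in> hom X \<K> (!\<^sub>o \<K>)"
    and mon_tensor_assoc: "\<lbrakk>A \<in> Obj X; B \<in> Obj X; C \<in> Obj X\<rbrakk>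
      \<Longrightarrow> (\<mm> A B \<otimes> \<one> (!\<^sub>o C)) \<Zsemi> \<mm> (A \<odot> B) C = (\<one> (!\<^sub>o A) \<otimes> \<mm> B C) \<Zsemi> \<mm> A (B \<odot> C)"
    and mon_unit_left: "A \<in> Obj X \<Longrightarrow> (\<mm>\<^sub>K \<otimes> \<one> (!\<^sub>o A)) \<Zsemi> \<mm> \<K> A = \<one> (!\<^sub>o A)"
    and mon_unit_right: "A \<in> Obj X \<Longrightarrow> (\<one> (!\<^sub>o A) \<otimes> \<mm>\<^sub>K) \<Zsemi> \<mm> A \<K> = \<one> (!\<^sub>o A)"
    and mon_tensor_symm: "\<lbrakk>A \<in> Obj X; B \<in> Obj X\<rbrakk>
      \<Longrightarrow> \<sigma> (!\<^sub>o A) (!\<^sub>o B) \<Zsemi> \<mm> B A = \<mm> A B \<Zsemi> !\<^sub>a (\<sigma> A B)"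
    and mon_tensor_comult: "\<lbrakk>A \<in> Obj X; B \<in> Obj X\<rbrakk>
      \<Longrightarrow> \<mm> A B \<Zsemi> \<delta> (A \<odot> B) = (\<delta> A \<otimes> \<delta> B) \<Zsemi> \<mm> (!\<^sub>o A) (!\<^sub>o B) \<Zsemi> !\<^sub>a (\<mm> A B)"
    and mon_unit_comult: "\<mm>\<^sub>K \<Zsemi> \<delta> \<K> = \<mm>\<^sub>K \<Zsemi> !\<^sub>a \<mm>\<^sub>K"
    and mon_tensor_counit: "\<lbrakk>A \<in> Obj X; B \<in> Obj X\<rbrakk> \<Longrightarrow> \<mm> A B \<Zsemi> \<epsilon> (A \<odot> B) = \<epsilon> A \<otimes> \<epsilon> B"
    and mon_unit_counit: "\<mm>\<^sub>K \<Zsemi> \<epsilon> \<K> = \<one> \<K>"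
    and mon_tensor_copy: "\<lbrakk>A \<in> Obj X; B \<in> Obj X\<rbrakk>
      \<Longrightarrow> \<mm> A B \<Zsemi> \<Delta> (A \<odot> B)
        = (\<Delta> A \<otimes> \<Delta> B) \<Zsemi> (\<one> (!\<^sub>o A) \<otimes> \<sigma> (!\<^sub>o A) (!\<^sub>o B) \<otimes> \<one> (!\<^sub>o B)) \<Zsemi> (\<mm> A B \<otimes> \<mm> A B)"
    and mon_tensor_discard: "\<lbrakk>A \<in> Obj X; B \<in> Obj X\<rbrakk> \<Longrightarrow> \<mm> A B \<Zsemi> \<ee> (A \<odot> B) = \<ee> A \<otimes> \<ee> B"
    and mon_unit_copy: "\<mm>\<^sub>K \<Zsemi> \<Delta> \<K> = \<mm>\<^sub>K \<otimes> \<mm>\<^sub>K"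
    and mon_unit_discard: "\<mm>\<^sub>K \<Zsemi> \<ee> \<K> = \<one> \<K>"
    and comult_bang_copy: "A \<in> Obj X
      \<Longrightarrow> \<delta> A \<Zsemi> !\<^sub>a (\<Delta> A) = \<Delta> A \<Zsemi> (\<delta> A \<otimes> \<delta> A) \<Zsemi> \<mm> (!\<^sub>o A) (!\<^sub>o A)"
    and comult_bang_discard: "A \<in> Obj X \<Longrightarrow> \<delta> A \<Zsemi> !\<^sub>a (\<ee> A) = \<ee> A \<Zsemi> \<mm>\<^sub>K"

locale additive_linear_category =
  additive_symmetric_monoidal_category X + monoidal_coalgebra_modality X
  for X :: "('o, 'a, 'x) additive_linear_category_scheme" (structure)

text \<open>By strictness, both \<open>\<epsilon> \<otimes> \<ee>\<close> and \<open>\<ee> \<otimes> \<epsilon>\<close> are arrows \<open>!A \<otimes> !A \<rightarrow> A\<close>.\<close>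

definition nabla :: "('o, 'a, 'x) additive_linear_category_scheme \<Rightarrow> 'o \<Rightarrow> 'a" ("\<nabla>\<index>") where
  "nabla X A = (\<delta> A \<otimes> \<delta> A) \<Zsemi> \<mm> (!\<^sub>o A) (!\<^sub>o A) \<Zsemi> !\<^sub>a (\<epsilon> A \<otimes> \<ee> A \<oplus> \<ee> A \<otimes> \<epsilon> A)"
  for X (structure)

definition induced_unit :: "('o, 'a, 'x) additive_linear_category_scheme \<Rightarrow> 'o \<Rightarrow> 'a" where
  "induced_unit X A = \<mm>\<^sub>K \<Zsemi> !\<^sub>a (\<zero> \<K> A)"
  for X (structure)

definition deriving_natural ::
  "('o, 'a, 'x) additive_linear_category_scheme \<Rightarrow> ('o \<Rightarrow> 'a) \<Rightarrow> bool" where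
  "deriving_natural X d \<longleftrightarrow>
    (\<forall>A \<in> Obj X. d A \<in> hom X (!\<^sub>o A \<odot> A) (!\<^sub>o A)) \<and>
    (\<forall>A B. \<forall>f \<in> hom X A B. (!\<^sub>a f \<otimes> f) \<Zsemi> d B = d A \<Zsemi> !\<^sub>a f)"
  for X (structure)

definition linear_rule ::
  "('o, 'a, 'x) additive_linear_category_scheme \<Rightarrow> ('o \<Rightarrow> 'a) \<Rightarrow> bool" where
  "linear_rule X d \<longleftrightarrow> (\<forall>A \<in> Obj X. d A \<Zsemi> \<epsilon> A = \<ee> A \<otimes> \<one> A)"
  for X (structure)

definition chain_rule ::
  "('o, 'a, 'x) additive_linear_category_scheme \<Rightarrow> ('o \<Rightarrow> 'a) \<Rightarrow> bool" where
  "chain_rule X d \<longleftrightarrow>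
    (\<forall>A \<in> Obj X. d A \<Zsemi> \<delta> A = (\<Delta> A \<otimes> \<one> A) \<Zsemi> (\<delta> A \<otimes> d A) \<Zsemi> d (!\<^sub>o A))"
  for X (structure)

definition leibniz_rule ::
  "('o, 'a, 'x) additive_linear_category_scheme \<Rightarrow> ('o \<Rightarrow> 'a) \<Rightarrow> bool" where
  "leibniz_rule X d \<longleftrightarrow>
    (\<forall>A \<in> Obj X. d A \<Zsemi> \<Delta> A =
      (\<Delta> A \<otimes> \<one> A) \<Zsemi>
        ((\<one> (!\<^sub>o A) \<otimes> d A) \<oplus> (\<one> (!\<^sub>o A) \<otimes> \<sigma> (!\<^sub>o A) A) \<Zsemi> (d A \<otimes> \<one> (!\<^sub>o A))))"
  for X (structure)

definition nabla_rule ::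
  "('o, 'a, 'x) additive_linear_category_scheme \<Rightarrow> ('o \<Rightarrow> 'a) \<Rightarrow> bool" where
  "nabla_rule X d \<longleftrightarrow>
    (\<forall>A \<in> Obj X. (\<nabla> A \<otimes> \<one> A) \<Zsemi> d A = (\<one> (!\<^sub>o A) \<otimes> d A) \<Zsemi> \<nabla> A)"
  for X (structure)

definition monoidal_rule ::
  "('o, 'a, 'x) additive_linear_category_scheme \<Rightarrow> ('o \<Rightarrow> 'a) \<Rightarrow> bool" where
  "monoidal_rule X d \<longleftrightarrow>
    (\<forall>A \<in> Obj X. \<forall>B \<in> Obj X. (\<one> (!\<^sub>o A) \<otimes> d B) \<Zsemi> \<mm> A B =
      (\<Delta> A \<otimes> \<one> (!\<^sub>o B) \<otimes> \<one> B) \<Zsemi> (\<one> (!\<^sub>o A) \<otimes> \<sigma> (!\<^sub>o A) (!\<^sub>o B) \<otimes> \<one> B) \<Zsemi>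
        (\<mm> A B \<otimes> \<epsilon> A \<otimes> \<one> B) \<Zsemi> d (A \<odot> B))"
  for X (structure)

end

theory Submission
  imports Defs
begin

text \<open>Everything rests on maps \<open>A \<leftarrow> W \<rightarrow> B\<close> exhibiting \<open>A \<oplus> B\<close> as a formal retract of some \<open>W\<close>. They
  turn \<open>!A \<otimes> !B\<close> into a retract of \<open>!W\<close> by \<open>join : !A \<otimes> !B \<rightarrow> !W\<close> and \<open>split = \<Delta> (!p0 \<otimes> !p1)\<close>, as
  in the Seely isomorphism. The pivot is the identity \<open>(join \<otimes> i1) d = (1 \<otimes> d) join\<close>. It follows from the
  \<open>\<nabla>\<close>-rule because \<open>join = (!i0 \<otimes> !i1) \<nabla>\<close>, and from the Leibniz rule by composing with \<open>split\<close>. It implies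
  the monoidal rule by the chain rule and \<open>\<mm> = join \<delta> !(split (\<epsilon> \<otimes> \<epsilon>))\<close>, and the Leibniz rule by
  naturality of \<open>d\<close> at \<open>i0 + i1\<close>, since \<open>\<Delta> = !(i0 + i1) split\<close> and \<open>!(i0 + i1) = \<Delta> join\<close>. The monoidal rule
  yields the \<open>\<nabla>\<close>-rule directly.\<close>

section \<open>Typing and rewriting rules for strict additive symmetric monoidal categories\<close>

lemma hom_iff [simp]: "f \<in> hom X A B \<longleftrightarrow> f \<in> Arr X \<and> Dom X f = A \<and> Cod X f = B"
  by (auto simp: hom_def)

context category
begin

lemma ident_arr [simp]:
  "A \<in> Obj X \<Longrightarrow> \<one> A \<in> Arr X" "A \<in> Obj X \<Longrightarrow> Dom X (\<one> A) = A" "A \<in> Obj X \<Longrightarrow> Cod X (\<one> A) = A"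
  using ident_hom by auto

lemma comp_arr [simp]:
  assumes "f \<in> Arr X" "g \<in> Arr X" "Cod X f = Dom X g"
  shows "f \<Zsemi> g \<in> Arr X" "Dom X (f \<Zsemi> g) = Dom X f" "Cod X (f \<Zsemi> g) = Cod X g"
  using comp_hom[of f "Dom X f" "Cod X f" g "Cod X g"] assms by auto

lemma comp_ident [simp]:
  "\<lbrakk>f \<in> Arr X; Dom X f = A\<rbrakk> \<Longrightarrow> \<one> A \<Zsemi> f = f"
  "\<lbrakk>f \<in> Arr X; Cod X f = B\<rbrakk> \<Longrightarrow> f \<Zsemi> \<one> B = f"
  using ident_left ident_right by auto

lemma comp_assoc_arr [simp]:
  "\<lbrakk>f \<in> Arr X; g \<in> Arr X; h \<in> Arr X; Cod X f = Dom X g; Cod X g = Dom X h\<rbrakk>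
    \<Longrightarrow> (f \<Zsemi> g) \<Zsemi> h = f \<Zsemi> (g \<Zsemi> h)"
  using comp_assoc by auto

text \<open>Composites are normalised to the right, so an equation about \<open>f \<Zsemi> g\<close>
  stops matching once another arrow follows; this form makes it applicable there.\<close>

lemma comp_extend:
  assumes "f \<Zsemi> g = k" "f \<in> Arr X" "g \<in> Arr X" "h \<in> Arr X" "Cod X f = Dom X g" "Cod X g = Dom X h"
  shows "f \<Zsemi> (g \<Zsemi> h) = k \<Zsemi> h"
  using assms by (metis comp_assoc_arr)

end

context symmetric_monoidal_category
begin

lemmas monoidal_obj [simp] = tensor_obj_closed unit_obj_closed tensor_obj_assoc
  tensor_obj_unit_left tensor_obj_unit_right

lemma Dom_Cod_obj [simp]: "f \<in> Arr X \<Longrightarrow> Dom X f \<in> Obj X" "f \<in> Arr X \<Longrightarrow> Cod X f \<in> Obj X"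
  using Dom_closed Cod_closed by auto

lemma tensor_arr [simp]:
  assumes "f \<in> Arr X" "g \<in> Arr X"
  shows "f \<otimes> g \<in> Arr X" "Dom X (f \<otimes> g) = Dom X f \<odot> Dom X g" "Cod X (f \<otimes> g) = Cod X f \<odot> Cod X g"
  using tensor_hom[of f "Dom X f" "Cod X f" g "Dom X g" "Cod X g"] assms by auto

lemma symm_arr [simp]:
  assumes "A \<in> Obj X" "B \<in> Obj X"
  shows "\<sigma> A B \<in> Arr X" "Dom X (\<sigma> A B) = A \<odot> B" "Cod X (\<sigma> A B) = B \<odot> A"
  using symm_hom assms by auto

lemmas tensor_simps [simp] = tensor_ident tensor_assoc tensor_unit_left tensor_unit_right

lemma interchange:
  "\<lbrakk>f \<in> Arr X; g \<in> Arr X; h \<in> Arr X; k \<in> Arr X; Cod X f = Dom X g; Cod X h = Dom X k\<rbrakk>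
    \<Longrightarrow> (f \<otimes> h) \<Zsemi> (g \<otimes> k) = (f \<Zsemi> g) \<otimes> (h \<Zsemi> k)"
  using tensor_comp by simp

lemma interchange_extend:
  "\<lbrakk>f \<in> Arr X; g \<in> Arr X; h \<in> Arr X; k \<in> Arr X; r \<in> Arr X; Cod X f = Dom X g; Cod X h = Dom X k;
    Cod X g \<odot> Cod X k = Dom X r\<rbrakk>
    \<Longrightarrow> (f \<otimes> h) \<Zsemi> ((g \<otimes> k) \<Zsemi> r) = ((f \<Zsemi> g) \<otimes> (h \<Zsemi> k)) \<Zsemi> r"
  by (rule comp_extend[OF interchange]) auto

text \<open>Naturality of the symmetry on the two inner factors. It moves arrows past the shuffle in
  the comultiplication of a tensor product of comonoids.\<close>

lemma middle_interchange:
  assumes "f \<in> hom X A A'" "g \<in> hom X B B'" "h \<in> hom X C C'" "k \<in> hom X D D'"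
  shows "(f \<otimes> g \<otimes> h \<otimes> k) \<Zsemi> (\<one> A' \<otimes> \<sigma> B' C' \<otimes> \<one> D')
    = (\<one> A \<otimes> \<sigma> B C \<otimes> \<one> D) \<Zsemi> (f \<otimes> h \<otimes> g \<otimes> k)"
proof -
  have "A \<in> Obj X" "A' \<in> Obj X" "B \<in> Obj X" "B' \<in> Obj X" "C \<in> Obj X" "C' \<in> Obj X" "D \<in> Obj X" "D' \<in> Obj X"
    using assms by auto
  note [simp] = this
  have "(f \<otimes> (g \<otimes> h) \<otimes> k) \<Zsemi> (\<one> A' \<otimes> \<sigma> B' C' \<otimes> \<one> D') = f \<otimes> ((g \<otimes> h) \<Zsemi> \<sigma> B' C') \<otimes> k"
    using assms by (simp add: interchange del: tensor_assoc)
  also have "\<dots> = f \<otimes> (\<sigma> B C \<Zsemi> (h \<otimes> g)) \<otimes> k"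
    using symm_natural[OF assms(2,3)] by simp
  also have "\<dots> = (\<one> A \<otimes> \<sigma> B C \<otimes> \<one> D) \<Zsemi> (f \<otimes> (h \<otimes> g) \<otimes> k)"
    using assms by (simp add: interchange del: tensor_assoc)
  finally show ?thesis using assms by simp
qed

end

context additive_symmetric_monoidal_category
begin

lemma add_arr [simp]:
  assumes "f \<in> Arr X" "g \<in> Arr X" "Dom X f = Dom X g" "Cod X f = Cod X g"
  shows "f \<oplus> g \<in> Arr X" "Dom X (f \<oplus> g) = Dom X g" "Cod X (f \<oplus> g) = Cod X g"
  using add_hom[of f "Dom X f" "Cod X f" g] assms by auto

lemma zero_arr [simp]:
  assumes "A \<in> Obj X" "B \<in> Obj X"
  shows "\<zero> A B \<in> Arr X" "Dom X (\<zero> A B) = A" "Cod X (\<zero> A B) = B"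
  using zero_hom assms by auto

lemma add_zero_arr [simp]:
  "\<lbrakk>f \<in> Arr X; Dom X f = A; Cod X f = B\<rbrakk> \<Longrightarrow> f \<oplus> \<zero> A B = f"
  "\<lbrakk>f \<in> Arr X; Dom X f = A; Cod X f = B\<rbrakk> \<Longrightarrow> \<zero> A B \<oplus> f = f"
proof -
  show right: "f \<oplus> \<zero> A B = f" if "f \<in> Arr X" "Dom X f = A" "Cod X f = B"
    using add_zero[of f A B] that by simp
  show "\<zero> A B \<oplus> f = f" if "f \<in> Arr X" "Dom X f = A" "Cod X f = B"
    using add_commute[of f A B "\<zero> A B"] right[OF that] that by auto
qed

lemma zero_simps [simp]:
  "\<lbrakk>A \<in> Obj X; f \<in> Arr X; Dom X f = B\<rbrakk> \<Longrightarrow> \<zero> A B \<Zsemi> f = \<zero> A (Cod X f)"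
  "\<lbrakk>C \<in> Obj X; f \<in> Arr X; Cod X f = B\<rbrakk> \<Longrightarrow> f \<Zsemi> \<zero> B C = \<zero> (Dom X f) C"
  "\<lbrakk>A \<in> Obj X; B \<in> Obj X; f \<in> Arr X\<rbrakk> \<Longrightarrow> \<zero> A B \<otimes> f = \<zero> (A \<odot> Dom X f) (B \<odot> Cod X f)"
  "\<lbrakk>A \<in> Obj X; B \<in> Obj X; f \<in> Arr X\<rbrakk> \<Longrightarrow> f \<otimes> \<zero> A B = \<zero> (Dom X f \<odot> A) (Cod X f \<odot> B)"
  by (rule comp_zero_left comp_zero_right tensor_zero_left tensor_zero_right; simp)+

lemma distribs:
  "\<lbrakk>f \<in> Arr X; g \<in> Arr X; h \<in> Arr X; Dom X f = Dom X g; Cod X f = Cod X g; Cod X g = Dom X h\<rbrakk>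
    \<Longrightarrow> (f \<oplus> g) \<Zsemi> h = f \<Zsemi> h \<oplus> g \<Zsemi> h"
  "\<lbrakk>f \<in> Arr X; g \<in> Arr X; h \<in> Arr X; Dom X g = Dom X h; Cod X g = Cod X h; Cod X f = Dom X h\<rbrakk>
    \<Longrightarrow> f \<Zsemi> (g \<oplus> h) = f \<Zsemi> g \<oplus> f \<Zsemi> h"
  "\<lbrakk>f \<in> Arr X; g \<in> Arr X; h \<in> Arr X; Dom X f = Dom X g; Cod X f = Cod X g\<rbrakk>
    \<Longrightarrow> (f \<oplus> g) \<otimes> h = f \<otimes> h \<oplus> g \<otimes> h"
  "\<lbrakk>f \<in> Arr X; g \<in> Arr X; h \<in> Arr X; Dom X g = Dom X h; Cod X g = Cod X h\<rbrakk>
    \<Longrightarrow> f \<otimes> (g \<oplus> h) = f \<otimes> g \<oplus> f \<otimes> h"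
  using comp_add_left comp_add_right tensor_add_left tensor_add_right by auto

end

section \<open>Coextensions and the comonoid structure on tensor products of cofree
  coalgebras\<close>

context monoidal_coalgebra_modality
begin

lemmas modality_obj [simp] = bang_obj_closed

lemma bang_arr [simp]:
  assumes "f \<in> Arr X"
  shows "!\<^sub>a f \<in> Arr X" "Dom X (!\<^sub>a f) = !\<^sub>o (Dom X f)" "Cod X (!\<^sub>a f) = !\<^sub>o (Cod X f)"
  using bang_hom[of f "Dom X f" "Cod X f"] assms by auto

lemma structure_arr [simp]:
  assumes "A \<in> Obj X"
  shows "\<delta> A \<in> Arr X" "Dom X (\<delta> A) = !\<^sub>o A" "Cod X (\<delta> A) = !\<^sub>o (!\<^sub>o A)"
    "\<epsilon> A \<in> Arr X" "Dom X (\<epsilon> A) = !\<^sub>o A" "Cod X (\<epsilon> A) = A"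
    "\<Delta> A \<in> Arr X" "Dom X (\<Delta> A) = !\<^sub>o A" "Cod X (\<Delta> A) = !\<^sub>o A \<odot> !\<^sub>o A"
    "\<ee> A \<in> Arr X" "Dom X (\<ee> A) = !\<^sub>o A" "Cod X (\<ee> A) = \<K>"
  using comult_hom counit_hom copy_hom discard_hom assms by auto

lemma mon_tensor_arr [simp]:
  assumes "A \<in> Obj X" "B \<in> Obj X"
  shows "\<mm> A B \<in> Arr X" "Dom X (\<mm> A B) = !\<^sub>o A \<odot> !\<^sub>o B" "Cod X (\<mm> A B) = !\<^sub>o (A \<odot> B)"
  using mon_tensor_hom assms by auto

lemma mon_unit_arr [simp]: "\<mm>\<^sub>K \<in> Arr X" "Dom X \<mm>\<^sub>K = \<K>" "Cod X \<mm>\<^sub>K = !\<^sub>o \<K>"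
  using mon_unit_hom by auto

lemma bang_ident_simp [simp]: "A \<in> Obj X \<Longrightarrow> !\<^sub>a (\<one> A) = \<one> (!\<^sub>o A)"
  by (rule bang_ident)

lemma bang_comp_arr:
  "\<lbrakk>f \<in> Arr X; g \<in> Arr X; Cod X f = Dom X g\<rbrakk> \<Longrightarrow> !\<^sub>a f \<Zsemi> !\<^sub>a g = !\<^sub>a (f \<Zsemi> g)"
  using bang_comp by simp

lemma copy_discard_comp:
  assumes "C \<in> Obj X" "f \<in> hom X (!\<^sub>o C) D"
  shows "\<Delta> C \<Zsemi> (f \<otimes> \<ee> C) = f" "\<Delta> C \<Zsemi> (\<ee> C \<otimes> f) = f"
proof -
  have [simp]: "D \<in> Obj X" "C \<in> Obj X"
    using assms by auto
  have "(\<one> (!\<^sub>o C) \<otimes> \<ee> C) \<Zsemi> (f \<otimes> \<one> \<K>) = f \<otimes> \<ee> C"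
    using assms by (subst interchange) simp_all
  then show "\<Delta> C \<Zsemi> (f \<otimes> \<ee> C) = f"
    using assms comp_extend[OF copy_discard_right, of C f] by simp
  have "(\<ee> C \<otimes> \<one> (!\<^sub>o C)) \<Zsemi> (\<one> \<K> \<otimes> f) = \<ee> C \<otimes> f"
    using assms by (subst interchange) simp_all
  then show "\<Delta> C \<Zsemi> (\<ee> C \<otimes> f) = f"
    using assms comp_extend[OF copy_discard_left, of C f] by simp
qed

text \<open>The coextension of \<open>f\<close> from the tensor product of the two cofree coalgebras: the unique
  \<open>!\<close>-coalgebra morphism \<open>g\<close> with \<open>g \<epsilon> = f\<close>.\<close>

definition coextend where
  "coextend A B f = (\<delta> A \<otimes> \<delta> B) \<Zsemi> \<mm> (!\<^sub>o A) (!\<^sub>o B) \<Zsemi> !\<^sub>a f"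

lemma coextend_arr [simp]:
  assumes "A \<in> Obj X" "B \<in> Obj X" "f \<in> Arr X" "Dom X f = !\<^sub>o A \<odot> !\<^sub>o B"
  shows "coextend A B f \<in> Arr X" "Dom X (coextend A B f) = !\<^sub>o A \<odot> !\<^sub>o B"
    "Cod X (coextend A B f) = !\<^sub>o (Cod X f)"
  using assms by (simp_all add: coextend_def)

lemma coextend_bang:
  assumes "A \<in> Obj X" "B \<in> Obj X" "f \<in> hom X (!\<^sub>o A \<odot> !\<^sub>o B) C" "g \<in> hom X C D"
  shows "coextend A B f \<Zsemi> !\<^sub>a g = coextend A B (f \<Zsemi> g)"
  using assms by (simp add: coextend_def bang_comp_arr)

text \<open>Naturality of \<open>\<delta>\<close> and \<open>\<mm>\<close> makes
  \<open>!\<^sub>a h \<otimes> !\<^sub>a k\<close> a coalgebra morphism, so it is absorbed into the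
  map being coextended.\<close>

lemma bang_tensor_coextend:
  assumes "h \<in> hom X A A'" "k \<in> hom X B B'" "f \<in> hom X (!\<^sub>o A' \<odot> !\<^sub>o B') C"
  shows "(!\<^sub>a h \<otimes> !\<^sub>a k) \<Zsemi> coextend A' B' f = coextend A B ((!\<^sub>a h \<otimes> !\<^sub>a k) \<Zsemi> f)"
proof -
  have [simp]: "A \<in> Obj X" "A' \<in> Obj X" "B \<in> Obj X" "B' \<in> Obj X"
    using assms by auto
  have "(!\<^sub>a h \<otimes> !\<^sub>a k) \<Zsemi> coextend A' B' f
    = ((!\<^sub>a h \<Zsemi> \<delta> A') \<otimes> (!\<^sub>a k \<Zsemi> \<delta> B')) \<Zsemi> \<mm> (!\<^sub>o A') (!\<^sub>o B') \<Zsemi> !\<^sub>a f"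
    using assms by (simp add: coextend_def interchange_extend)
  also have "\<dots> = (\<delta> A \<otimes> \<delta> B) \<Zsemi> ((!\<^sub>a (!\<^sub>a h) \<otimes> !\<^sub>a (!\<^sub>a k)) \<Zsemi> \<mm> (!\<^sub>o A') (!\<^sub>o B')) \<Zsemi> !\<^sub>a f"
    using assms comult_natural[of h A A'] comult_natural[of k B B'] by (simp add: interchange_extend)
  also have "\<dots> = coextend A B ((!\<^sub>a h \<otimes> !\<^sub>a k) \<Zsemi> f)"
    using assms mon_tensor_natural[of "!\<^sub>a h" "!\<^sub>o A" "!\<^sub>o A'" "!\<^sub>a k" "!\<^sub>o B" "!\<^sub>o B'"]
    by (simp add: coextend_def bang_comp_arr)
  finally show ?thesis .
qed

text \<open>The coalgebra structure on \<open>!A \<otimes> !B\<close> is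
  \<open>\<delta> \<otimes> \<delta>\<close> followed by \<open>\<mm>\<close>, so this equation is
  what makes a coextension a coalgebra morphism. It follows from monoidality and coassociativity of
  \<open>\<delta>\<close>.\<close>

lemma coextend_comult:
  assumes [simp]: "A \<in> Obj X" "B \<in> Obj X" and "f \<in> hom X (!\<^sub>o A \<odot> !\<^sub>o B) C"
  shows "coextend A B f \<Zsemi> \<delta> C = coextend A B (coextend A B f)"
proof -
  have "coextend A B f \<Zsemi> \<delta> C
    = (\<delta> A \<otimes> \<delta> B) \<Zsemi> (\<mm> (!\<^sub>o A) (!\<^sub>o B) \<Zsemi> \<delta> (!\<^sub>o A \<odot> !\<^sub>o B)) \<Zsemi> !\<^sub>a (!\<^sub>a f)"
    using assms comult_natural[OF assms(3)] by (auto simp: coextend_def)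
  also have "\<dots> = ((\<delta> A \<Zsemi> \<delta> (!\<^sub>o A)) \<otimes> (\<delta> B \<Zsemi> \<delta> (!\<^sub>o B))) \<Zsemi> \<mm> (!\<^sub>o (!\<^sub>o A)) (!\<^sub>o (!\<^sub>o B))
      \<Zsemi> !\<^sub>a (\<mm> (!\<^sub>o A) (!\<^sub>o B) \<Zsemi> !\<^sub>a f)"
    using assms by (simp add: mon_tensor_comult interchange_extend bang_comp_arr)
  also have "\<dots> = (\<delta> A \<otimes> \<delta> B) \<Zsemi> ((!\<^sub>a (\<delta> A) \<otimes> !\<^sub>a (\<delta> B)) \<Zsemi> \<mm> (!\<^sub>o (!\<^sub>o A)) (!\<^sub>o (!\<^sub>o B)))
      \<Zsemi> !\<^sub>a (\<mm> (!\<^sub>o A) (!\<^sub>o B) \<Zsemi> !\<^sub>a f)"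
    using assms by (simp add: comult_comult interchange_extend)
  also have "\<dots> = coextend A B (coextend A B f)"
    using assms mon_tensor_natural[of "\<delta> A" "!\<^sub>o A" "!\<^sub>o (!\<^sub>o A)" "\<delta> B" "!\<^sub>o B" "!\<^sub>o (!\<^sub>o B)"]
    by (simp add: coextend_def bang_comp_arr)
  finally show ?thesis .
qed

lemma coextend_tensor:
  assumes [simp]: "A \<in> Obj X" "B \<in> Obj X" and "f \<in> hom X (!\<^sub>o A) C" "g \<in> hom X (!\<^sub>o B) D"
  shows "coextend A B (f \<otimes> g) = ((\<delta> A \<Zsemi> !\<^sub>a f) \<otimes> (\<delta> B \<Zsemi> !\<^sub>a g)) \<Zsemi> \<mm> C D"
proof -
  have [simp]: "C \<in> Obj X" "D \<in> Obj X"
    using assms by auto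
  have "coextend A B (f \<otimes> g) = (\<delta> A \<otimes> \<delta> B) \<Zsemi> (!\<^sub>a f \<otimes> !\<^sub>a g) \<Zsemi> \<mm> C D"
    using assms mon_tensor_natural[OF assms(3,4)] by (simp add: coextend_def)
  then show ?thesis
    using assms by (simp add: interchange_extend)
qed

text \<open>By \<open>coextend_tensor\<close> each factor is treated alone:
  \<open>\<epsilon>\<close> coextends to an identity and \<open>\<ee>\<close> to
  \<open>\<ee> \<Zsemi> \<mm>\<^sub>K\<close>, where the unit laws absorb
  \<open>\<mm>\<^sub>K\<close>.\<close>

lemma coextend_counit_discard:
  assumes [simp]: "A \<in> Obj X" "B \<in> Obj X"
  shows "coextend A B (\<epsilon> A \<otimes> \<ee> B) = \<one> (!\<^sub>o A) \<otimes> \<ee> B"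
    and "coextend A B (\<ee> A \<otimes> \<epsilon> B) = \<ee> A \<otimes> \<one> (!\<^sub>o B)"
    and "coextend A B (\<epsilon> A \<otimes> \<epsilon> B) = \<mm> A B"
proof -
  have "coextend A B (\<epsilon> A \<otimes> \<ee> B) = (\<one> (!\<^sub>o A) \<otimes> (\<ee> B \<Zsemi> \<mm>\<^sub>K)) \<Zsemi> \<mm> A \<K>"
    by (simp add: coextend_tensor comult_bang_counit comult_bang_discard)
  also have "\<dots> = ((\<one> (!\<^sub>o A) \<otimes> \<ee> B) \<Zsemi> (\<one> (!\<^sub>o A) \<otimes> \<mm>\<^sub>K)) \<Zsemi> \<mm> A \<K>"
    by (subst interchange) simp_all
  finally show "coextend A B (\<epsilon> A \<otimes> \<ee> B) = \<one> (!\<^sub>o A) \<otimes> \<ee> B"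
    by (simp add: mon_unit_right)
  have "coextend A B (\<ee> A \<otimes> \<epsilon> B) = ((\<ee> A \<Zsemi> \<mm>\<^sub>K) \<otimes> \<one> (!\<^sub>o B)) \<Zsemi> \<mm> \<K> B"
    by (simp add: coextend_tensor comult_bang_counit comult_bang_discard)
  also have "\<dots> = ((\<ee> A \<otimes> \<one> (!\<^sub>o B)) \<Zsemi> (\<mm>\<^sub>K \<otimes> \<one> (!\<^sub>o B))) \<Zsemi> \<mm> \<K> B"
    by (subst interchange) simp_all
  finally show "coextend A B (\<ee> A \<otimes> \<epsilon> B) = \<ee> A \<otimes> \<one> (!\<^sub>o B)"
    by (simp add: mon_unit_left)
  show "coextend A B (\<epsilon> A \<otimes> \<epsilon> B) = \<mm> A B"
    by (simp add: coextend_tensor comult_bang_counit)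
qed

text \<open>The comultiplication of the tensor product comonoid on
  \<open>!A \<otimes> !B\<close>.\<close>

definition copy_tensor where
  "copy_tensor A B = (\<Delta> A \<otimes> \<Delta> B) \<Zsemi> (\<one> (!\<^sub>o A) \<otimes> \<sigma> (!\<^sub>o A) (!\<^sub>o B) \<otimes> \<one> (!\<^sub>o B))"

lemma copy_tensor_arr [simp]:
  assumes "A \<in> Obj X" "B \<in> Obj X"
  shows "copy_tensor A B \<in> Arr X" "Dom X (copy_tensor A B) = !\<^sub>o A \<odot> !\<^sub>o B"
    "Cod X (copy_tensor A B) = !\<^sub>o A \<odot> !\<^sub>o B \<odot> !\<^sub>o A \<odot> !\<^sub>o B"
  using assms by (simp_all add: copy_tensor_def)

lemma copy_tensor_comp:
  assumes [simp]: "A \<in> Obj X" "B \<in> Obj X"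
    and "f \<in> hom X (!\<^sub>o A) C" "g \<in> hom X (!\<^sub>o B) D" "h \<in> hom X (!\<^sub>o A) C'" "k \<in> hom X (!\<^sub>o B) D'"
  shows "copy_tensor A B \<Zsemi> (f \<otimes> g \<otimes> h \<otimes> k)
    = ((\<Delta> A \<Zsemi> (f \<otimes> h)) \<otimes> (\<Delta> B \<Zsemi> (g \<otimes> k))) \<Zsemi> (\<one> C \<otimes> \<sigma> C' D \<otimes> \<one> D')"
proof -
  have [simp]: "C \<in> Obj X" "D \<in> Obj X" "C' \<in> Obj X" "D' \<in> Obj X"
    using assms by auto
  have "copy_tensor A B \<Zsemi> (f \<otimes> g \<otimes> h \<otimes> k)
    = (\<Delta> A \<otimes> \<Delta> B) \<Zsemi> ((f \<otimes> h) \<otimes> (g \<otimes> k)) \<Zsemi> (\<one> C \<otimes> \<sigma> C' D \<otimes> \<one> D')"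
    using assms middle_interchange[OF assms(3,5,4,6)] by (simp add: copy_tensor_def)
  then show ?thesis
    using assms by (simp add: interchange_extend del: tensor_assoc)
qed

text \<open>Discarding one of two copies undoes \<open>\<Delta>\<close>, and the shuffle becomes
  trivial wherever it meets the unit object.\<close>

lemma copy_tensor_discard:
  assumes [simp]: "A \<in> Obj X" "B \<in> Obj X"
  shows "copy_tensor A B \<Zsemi> (\<one> (!\<^sub>o A) \<otimes> \<ee> B \<otimes> \<ee> A \<otimes> \<one> (!\<^sub>o B)) = \<one> (!\<^sub>o A \<odot> !\<^sub>o B)"
    and "copy_tensor A B \<Zsemi> (\<one> (!\<^sub>o A \<odot> !\<^sub>o B) \<otimes> \<ee> A \<otimes> \<ee> B) = \<one> (!\<^sub>o A \<odot> !\<^sub>o B)"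
    and "copy_tensor A B \<Zsemi> (\<one> (!\<^sub>o A \<odot> !\<^sub>o B) \<otimes> \<one> (!\<^sub>o A) \<otimes> \<ee> B)
      = (\<Delta> A \<otimes> \<one> (!\<^sub>o B)) \<Zsemi> (\<one> (!\<^sub>o A) \<otimes> \<sigma> (!\<^sub>o A) (!\<^sub>o B))"
proof -
  have [simp]: "\<sigma> \<K> C = \<one> C" if "C \<in> Obj X" for C
    using symm_symm[of C \<K>] that by (simp add: symm_unit)
  have unit: "\<one> (!\<^sub>o A \<odot> !\<^sub>o B) \<otimes> f = \<one> (!\<^sub>o A) \<otimes> \<one> (!\<^sub>o B) \<otimes> f" if "f \<in> Arr X" for f
    using that by (simp flip: tensor_ident)
  show "copy_tensor A B \<Zsemi> (\<one> (!\<^sub>o A) \<otimes> \<ee> B \<otimes> \<ee> A \<otimes> \<one> (!\<^sub>o B)) = \<one> (!\<^sub>o A \<odot> !\<^sub>o B)"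
    by (subst copy_tensor_comp) (auto simp: copy_discard_left copy_discard_right)
  show "copy_tensor A B \<Zsemi> (\<one> (!\<^sub>o A \<odot> !\<^sub>o B) \<otimes> \<ee> A \<otimes> \<ee> B) = \<one> (!\<^sub>o A \<odot> !\<^sub>o B)"
    by (subst unit, simp, subst copy_tensor_comp) (auto simp: copy_discard_left copy_discard_right)
  show "copy_tensor A B \<Zsemi> (\<one> (!\<^sub>o A \<odot> !\<^sub>o B) \<otimes> \<one> (!\<^sub>o A) \<otimes> \<ee> B)
      = (\<Delta> A \<otimes> \<one> (!\<^sub>o B)) \<Zsemi> (\<one> (!\<^sub>o A) \<otimes> \<sigma> (!\<^sub>o A) (!\<^sub>o B))"
    by (subst unit, simp, subst copy_tensor_comp) (auto simp: copy_discard_left copy_discard_right)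
qed

lemma copy_tensor_discard_comp:
  assumes [simp]: "A \<in> Obj X" "B \<in> Obj X" and "f \<in> hom X (!\<^sub>o A \<odot> !\<^sub>o B) C"
  shows "copy_tensor A B \<Zsemi> (f \<otimes> \<ee> A \<otimes> \<ee> B) = f"
proof -
  have [simp]: "C \<in> Obj X"
    using assms by auto
  have "(\<one> (!\<^sub>o A \<odot> !\<^sub>o B) \<otimes> \<ee> A \<otimes> \<ee> B) \<Zsemi> (f \<otimes> \<one> \<K>) = f \<otimes> \<ee> A \<otimes> \<ee> B"
    using assms by (subst interchange) simp_all
  then show ?thesis
    using assms comp_extend[OF copy_tensor_discard(2), of A B f] by simp
qed

text \<open>Each of \<open>\<delta>\<close>, \<open>\<mm>\<close> and \<open>!f\<close> is
  compatible with comultiplication, hence so is their composite.\<close>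

lemma coextend_copy:
  assumes [simp]: "A \<in> Obj X" "B \<in> Obj X" and "f \<in> hom X (!\<^sub>o A \<odot> !\<^sub>o B) C"
  shows "coextend A B f \<Zsemi> \<Delta> C = copy_tensor A B \<Zsemi> (coextend A B f \<otimes> coextend A B f)"
proof -
  have "coextend A B f \<Zsemi> \<Delta> C = (\<delta> A \<otimes> \<delta> B) \<Zsemi> (\<mm> (!\<^sub>o A) (!\<^sub>o B) \<Zsemi> \<Delta> (!\<^sub>o A \<odot> !\<^sub>o B)) \<Zsemi> (!\<^sub>a f \<otimes> !\<^sub>a f)"
    using assms copy_natural[OF assms(3)] by (auto simp: coextend_def)
  also have "\<dots> = ((\<delta> A \<Zsemi> \<Delta> (!\<^sub>o A)) \<otimes> (\<delta> B \<Zsemi> \<Delta> (!\<^sub>o B)))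
      \<Zsemi> (\<one> (!\<^sub>o (!\<^sub>o A)) \<otimes> \<sigma> (!\<^sub>o (!\<^sub>o A)) (!\<^sub>o (!\<^sub>o B)) \<otimes> \<one> (!\<^sub>o (!\<^sub>o B)))
      \<Zsemi> ((\<mm> (!\<^sub>o A) (!\<^sub>o B) \<Zsemi> !\<^sub>a f) \<otimes> (\<mm> (!\<^sub>o A) (!\<^sub>o B) \<Zsemi> !\<^sub>a f))"
    using assms by (simp add: mon_tensor_copy interchange interchange_extend)
  also have "\<dots> = copy_tensor A B \<Zsemi> (\<delta> A \<otimes> \<delta> B \<otimes> \<delta> A \<otimes> \<delta> B)
      \<Zsemi> ((\<mm> (!\<^sub>o A) (!\<^sub>o B) \<Zsemi> !\<^sub>a f) \<otimes> (\<mm> (!\<^sub>o A) (!\<^sub>o B) \<Zsemi> !\<^sub>a f))"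
    using assms by (subst copy_tensor_comp) (auto simp: comult_copy)
  also have "\<dots> = copy_tensor A B \<Zsemi> (((\<delta> A \<otimes> \<delta> B) \<otimes> (\<delta> A \<otimes> \<delta> B))
      \<Zsemi> ((\<mm> (!\<^sub>o A) (!\<^sub>o B) \<Zsemi> !\<^sub>a f) \<otimes> (\<mm> (!\<^sub>o A) (!\<^sub>o B) \<Zsemi> !\<^sub>a f)))"
    using assms by simp
  also have "\<dots> = copy_tensor A B \<Zsemi> (coextend A B f \<otimes> coextend A B f)"
    using assms by (simp add: interchange coextend_def del: tensor_assoc)
  finally show ?thesis .
qed

text \<open>\<open>\<Delta>\<close> is a coalgebra morphism by \<open>comult_bang_copy\<close>, so
  composing it with a coextension gives a coextension from \<open>!A\<close> itself.\<close>

lemma copy_coextend: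
  assumes [simp]: "A \<in> Obj X" and "f \<in> hom X (!\<^sub>o A \<odot> !\<^sub>o A) C"
  shows "\<Delta> A \<Zsemi> coextend A A f = \<delta> A \<Zsemi> !\<^sub>a (\<Delta> A \<Zsemi> f)"
proof -
  have "\<Delta> A \<Zsemi> coextend A A f = (\<Delta> A \<Zsemi> (\<delta> A \<otimes> \<delta> A) \<Zsemi> \<mm> (!\<^sub>o A) (!\<^sub>o A)) \<Zsemi> !\<^sub>a f"
    using assms by (simp add: coextend_def)
  also have "\<dots> = \<delta> A \<Zsemi> !\<^sub>a (\<Delta> A \<Zsemi> f)"
    using assms comult_bang_copy[of A, symmetric] by (simp add: bang_comp_arr)
  finally show ?thesis .
qed

end

section \<open>Formal retracts and the Seely-type maps they induce\<close>

text \<open>The equations only make \<open>p0 \<Zsemi> i0 \<oplus> p1 \<Zsemi> i1\<close> an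
  idempotent of \<open>W\<close>; in a biproduct it would be the identity.\<close>

locale weak_biproduct = additive_linear_category X
  for X :: "('o, 'a, 'x) additive_linear_category_scheme" (structure) +
  fixes A B W :: 'o and i0 i1 p0 p1 :: 'a
  assumes obj [simp]: "A \<in> Obj X" "B \<in> Obj X" "W \<in> Obj X"
    and inj_hom: "i0 \<in> hom X A W" "i1 \<in> hom X B W"
    and proj_hom: "p0 \<in> hom X W A" "p1 \<in> hom X W B"
    and inj_proj [simp]: "i0 \<Zsemi> p0 = \<one> A" "i1 \<Zsemi> p1 = \<one> B"
      "i0 \<Zsemi> p1 = \<zero> A B" "i1 \<Zsemi> p0 = \<zero> B A"
begin

lemma inj_arr [simp]:
  "i0 \<in> Arr X" "Dom X i0 = A" "Cod X i0 = W" "i1 \<in> Arr X" "Dom X i1 = B" "Cod X i1 = W"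
  "p0 \<in> Arr X" "Dom X p0 = W" "Cod X p0 = A" "p1 \<in> Arr X" "Dom X p1 = W" "Cod X p1 = B"
  using inj_hom proj_hom by auto

text \<open>The composite of \<open>join\<close> with \<open>\<epsilon>\<close>: each summand reads
  one factor and discards the other.\<close>

definition injection where
  "injection = (\<epsilon> A \<Zsemi> i0) \<otimes> \<ee> B \<oplus> \<ee> A \<otimes> (\<epsilon> B \<Zsemi> i1)"

definition join where
  "join = coextend A B injection"

definition split where
  "split = \<Delta> W \<Zsemi> (!\<^sub>a p0 \<otimes> !\<^sub>a p1)"

lemma injection_arr [simp]:
  "injection \<in> Arr X" "Dom X injection = !\<^sub>o A \<odot> !\<^sub>o B" "Cod X injection = W"
  by (simp_all add: injection_def)

lemma join_arr [simp]: "join \<in> Arr X" "Dom X join = !\<^sub>o A \<odot> !\<^sub>o B" "Cod X join = !\<^sub>o W"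
  by (simp_all add: join_def)

lemma split_arr [simp]: "split \<in> Arr X" "Dom X split = !\<^sub>o W" "Cod X split = !\<^sub>o A \<odot> !\<^sub>o B"
  by (simp_all add: split_def)

lemma injection_comp:
  assumes "f \<in> hom X W C"
  shows "injection \<Zsemi> f = (\<epsilon> A \<Zsemi> (i0 \<Zsemi> f)) \<otimes> \<ee> B \<oplus> \<ee> A \<otimes> (\<epsilon> B \<Zsemi> (i1 \<Zsemi> f))"
proof -
  have [simp]: "C \<in> Obj X"
    using assms by auto
  have "((\<epsilon> A \<Zsemi> i0) \<otimes> \<ee> B) \<Zsemi> (f \<otimes> \<one> \<K>) = (\<epsilon> A \<Zsemi> (i0 \<Zsemi> f)) \<otimes> \<ee> B"
    using assms by (subst interchange) simp_all
  moreover have "(\<ee> A \<otimes> (\<epsilon> B \<Zsemi> i1)) \<Zsemi> (\<one> \<K> \<otimes> f) = \<ee> A \<otimes> (\<epsilon> B \<Zsemi> (i1 \<Zsemi> f))"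
    using assms by (subst interchange) simp_all
  ultimately show ?thesis
    using assms by (simp add: injection_def distribs)
qed

lemma join_bang:
  assumes "f \<in> hom X W C"
  shows "join \<Zsemi> !\<^sub>a f = coextend A B ((\<epsilon> A \<Zsemi> (i0 \<Zsemi> f)) \<otimes> \<ee> B \<oplus> \<ee> A \<otimes> (\<epsilon> B \<Zsemi> (i1 \<Zsemi> f)))"
  using assms coextend_bang[of A B injection W f C] by (simp add: join_def injection_comp)

text \<open>The relations between injections and projections kill one summand of
  \<open>injection\<close>; \<open>coextend_counit_discard\<close> evaluates the other.\<close>

lemma join_bang_proj:
  "join \<Zsemi> !\<^sub>a p0 = \<one> (!\<^sub>o A) \<otimes> \<ee> B" "join \<Zsemi> !\<^sub>a p1 = \<ee> A \<otimes> \<one> (!\<^sub>o B)"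
  using join_bang[of p0 A] join_bang[of p1 B] by (simp_all add: coextend_counit_discard)

lemma join_copy: "join \<Zsemi> \<Delta> W = copy_tensor A B \<Zsemi> (join \<otimes> join)"
  using coextend_copy[of A B injection W] by (simp add: join_def)

text \<open>\<open>join\<close> preserves copying, so \<open>split\<close> receives two joined
  copies; one projection keeps \<open>!A\<close> from the first, the other keeps \<open>!B\<close>
  from the second.\<close>

lemma join_split [simp]: "join \<Zsemi> split = \<one> (!\<^sub>o A \<odot> !\<^sub>o B)"
proof -
  have "join \<Zsemi> split = (join \<Zsemi> \<Delta> W) \<Zsemi> (!\<^sub>a p0 \<otimes> !\<^sub>a p1)"
    by (simp add: split_def)
  also have "\<dots> = copy_tensor A B \<Zsemi> ((join \<Zsemi> !\<^sub>a p0) \<otimes> (join \<Zsemi> !\<^sub>a p1))"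
    by (simp add: join_copy interchange)
  finally show ?thesis
    by (simp add: join_bang_proj copy_tensor_discard)
qed

lemma join_split_extend [simp]:
  "\<lbrakk>f \<in> Arr X; Dom X f = !\<^sub>o A \<odot> !\<^sub>o B\<rbrakk> \<Longrightarrow> join \<Zsemi> (split \<Zsemi> f) = f"
  by (subst comp_extend[OF join_split]) auto

definition idem where
  "idem = p0 \<Zsemi> i0 \<oplus> p1 \<Zsemi> i1"

lemma idem_arr [simp]: "idem \<in> Arr X" "Dom X idem = W" "Cod X idem = W"
  by (simp_all add: idem_def)

lemma inj_idem: "i0 \<Zsemi> idem = i0" "i1 \<Zsemi> idem = i1"
  by (simp_all add: idem_def distribs comp_extend[OF inj_proj(1)] comp_extend[OF inj_proj(2)]
      comp_extend[OF inj_proj(3)] comp_extend[OF inj_proj(4)])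

lemma join_idem: "join \<Zsemi> !\<^sub>a idem = join"
  using join_bang[of idem W] by (simp add: inj_idem) (simp add: join_def injection_def)

text \<open>This replaces additivity of \<open>!\<close>: a sum inside \<open>!\<close> becomes a
  copy followed by \<open>join\<close>. The left side is a coalgebra morphism out of
  \<open>!C\<close>, hence determined by its composite with \<open>\<epsilon>\<close>, which the
  counit laws evaluate.\<close>

lemma copy_bang_join:
  assumes "f \<in> hom X C A" "g \<in> hom X C B"
  shows "\<Delta> C \<Zsemi> (!\<^sub>a f \<otimes> !\<^sub>a g) \<Zsemi> join = !\<^sub>a (f \<Zsemi> i0 \<oplus> g \<Zsemi> i1)"
proof -
  have [simp]: "C \<in> Obj X"
    using assms by auto
  have "(!\<^sub>a f \<otimes> !\<^sub>a g) \<Zsemi> injection = (\<epsilon> C \<Zsemi> (f \<Zsemi> i0)) \<otimes> \<ee> C \<oplus> \<ee> C \<otimes> (\<epsilon> C \<Zsemi> (g \<Zsemi> i1))"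
    using assms comp_extend[OF counit_natural, OF assms(1), of i0]
      comp_extend[OF counit_natural, OF assms(2), of i1]
      discard_natural[OF assms(1)] discard_natural[OF assms(2)]
    by (simp add: injection_def distribs interchange)
  then have "\<Delta> C \<Zsemi> ((!\<^sub>a f \<otimes> !\<^sub>a g) \<Zsemi> injection) = \<epsilon> C \<Zsemi> (f \<Zsemi> i0 \<oplus> g \<Zsemi> i1)"
    using assms by (simp add: distribs copy_discard_comp)
  moreover have "\<Delta> C \<Zsemi> (!\<^sub>a f \<otimes> !\<^sub>a g) \<Zsemi> join = \<delta> C \<Zsemi> !\<^sub>a (\<Delta> C \<Zsemi> ((!\<^sub>a f \<otimes> !\<^sub>a g) \<Zsemi> injection))"
    using assms bang_tensor_coextend[OF assms, of injection W]
      copy_coextend[of C "(!\<^sub>a f \<otimes> !\<^sub>a g) \<Zsemi> injection" W] by (simp add: join_def)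
  ultimately show ?thesis
    using assms comp_extend[OF comult_bang_counit, of C "!\<^sub>a (f \<Zsemi> i0 \<oplus> g \<Zsemi> i1)"]
    by (simp flip: bang_comp_arr)
qed

text \<open>Together with \<open>join_split\<close> this makes \<open>!A \<otimes> !B\<close> a
  splitting of the idempotent \<open>!idem\<close>.\<close>

lemma split_join: "split \<Zsemi> join = !\<^sub>a idem"
  using copy_bang_join[of p0 W p1] by (simp add: split_def idem_def)

text \<open>Naturality of \<open>\<epsilon>\<close> and \<open>\<ee>\<close> turns the sum inside
  \<open>\<nabla> W\<close> into \<open>injection\<close>. Through this factorisation the
  \<nabla>-rule acts on \<open>join\<close>.\<close>

lemma join_nabla: "join = (!\<^sub>a i0 \<otimes> !\<^sub>a i1) \<Zsemi> \<nabla> W"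
proof -
  have "(!\<^sub>a i0 \<otimes> !\<^sub>a i1) \<Zsemi> (\<epsilon> W \<otimes> \<ee> W \<oplus> \<ee> W \<otimes> \<epsilon> W) = injection"
    using counit_natural[of i0 A W] counit_natural[of i1 B W]
      discard_natural[of i0 A W] discard_natural[of i1 B W]
    by (simp add: injection_def distribs interchange)
  then show ?thesis
    using bang_tensor_coextend[of i0 A W i1 B W "\<epsilon> W \<otimes> \<ee> W \<oplus> \<ee> W \<otimes> \<epsilon> W" W]
    by (simp add: join_def nabla_def coextend_def)
qed

end

section \<open>Deriving transformations, codereliction, and the monoidal rule for
  coextensions\<close>

locale deriving = additive_linear_category X
  for X :: "('o, 'a, 'x) additive_linear_category_scheme" (structure) +
  fixes d :: "'o \<Rightarrow> 'a"
  assumes deriving_natural: "deriving_natural X d"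
    and linear_rule: "linear_rule X d"
    and chain_rule: "chain_rule X d"
begin

lemma deriving_arr [simp]:
  assumes "A \<in> Obj X"
  shows "d A \<in> Arr X" "Dom X (d A) = !\<^sub>o A \<odot> A" "Cod X (d A) = !\<^sub>o A"
  using deriving_natural assms by (auto simp: deriving_natural_def)

lemma deriving_bang: "f \<in> hom X A B \<Longrightarrow> (!\<^sub>a f \<otimes> f) \<Zsemi> d B = d A \<Zsemi> !\<^sub>a f"
  using deriving_natural by (simp add: deriving_natural_def)

lemma deriving_counit: "A \<in> Obj X \<Longrightarrow> d A \<Zsemi> \<epsilon> A = \<ee> A \<otimes> \<one> A"
  using linear_rule by (simp add: linear_rule_def)

lemma deriving_comult:
  "A \<in> Obj X \<Longrightarrow> d A \<Zsemi> \<delta> A = (\<Delta> A \<otimes> \<one> A) \<Zsemi> ((\<delta> A \<otimes> d A) \<Zsemi> d (!\<^sub>o A))"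
  using chain_rule by (simp add: chain_rule_def)

text \<open>Naturality of \<open>d\<close> at the zero map forces the constant rule.\<close>

lemma deriving_discard:
  assumes [simp]: "A \<in> Obj X"
  shows "d A \<Zsemi> \<ee> A = \<zero> (!\<^sub>o A \<odot> A) \<K>"
proof -
  have "d A \<Zsemi> \<ee> A = d A \<Zsemi> (!\<^sub>a (\<zero> A A) \<Zsemi> \<ee> A)"
    using discard_natural[of "\<zero> A A" A A] by simp
  also have "\<dots> = \<zero> (!\<^sub>o A \<odot> A) \<K>"
    using comp_extend[OF deriving_bang[of "\<zero> A A" A A], symmetric, of "\<ee> A"] by simp
  finally show ?thesis .
qed

lemma induced_unit_arr [simp]:
  assumes "A \<in> Obj X"
  shows "induced_unit X A \<in> Arr X" "Dom X (induced_unit X A) = \<K>" "Cod X (induced_unit X A) = !\<^sub>o A"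
  using assms by (simp_all add: induced_unit_def)

lemma induced_unit_discard: "A \<in> Obj X \<Longrightarrow> induced_unit X A \<Zsemi> \<ee> A = \<one> \<K>"
  using discard_natural[of "\<zero> \<K> A" \<K> A] by (simp add: induced_unit_def mon_unit_discard)

lemma induced_unit_counit: "A \<in> Obj X \<Longrightarrow> induced_unit X A \<Zsemi> \<epsilon> A = \<zero> \<K> A"
  using counit_natural[of "\<zero> \<K> A" \<K> A] by (simp add: induced_unit_def)

text \<open>The usual codereliction \<open>A \<rightarrow> !A\<close>, that is, differentiation at
  the point zero given by the unit \<open>u\<close>.\<close>

definition codereliction where
  "codereliction A = (induced_unit X A \<otimes> \<one> A) \<Zsemi> d A"

lemma codereliction_arr [simp]:
  assumes "A \<in> Obj X"
  shows "codereliction A \<in> Arr X" "Dom X (codereliction A) = A" "Cod X (codereliction A) = !\<^sub>o A"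
  using assms by (simp_all add: codereliction_def)

lemma codereliction_counit: "A \<in> Obj X \<Longrightarrow> codereliction A \<Zsemi> \<epsilon> A = \<one> A"
  by (simp add: codereliction_def deriving_counit interchange induced_unit_discard)

lemma codereliction_discard: "A \<in> Obj X \<Longrightarrow> codereliction A \<Zsemi> \<ee> A = \<zero> A \<K>"
  by (simp add: codereliction_def deriving_discard)

text \<open>Without biproducts, \<open>!A \<otimes> !B\<close> still contains the biproduct of \<open>A\<close> and \<open>B\<close> as a formal
  retract: \<open>A\<close> sits in it by the codereliction.\<close>

lemma weak_biproduct_tensor:
  assumes [simp]: "A \<in> Obj X" "B \<in> Obj X"
  shows "weak_biproduct X A B (!\<^sub>o A \<odot> !\<^sub>o B) (codereliction A \<otimes> induced_unit X B)
    (induced_unit X A \<otimes> codereliction B) (\<epsilon> A \<otimes> \<ee> B) (\<ee> A \<otimes> \<epsilon> B)"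
  by unfold_locales
    (simp_all add: interchange codereliction_counit codereliction_discard induced_unit_counit
      induced_unit_discard)

text \<open>The monoidal rule concerns \<open>\<mm>\<close>, the coextension of
  \<open>\<epsilon> \<otimes> \<epsilon>\<close>. The chain rule transports it to any coextension,
  with the derivative of \<open>f\<close> in its second argument as the new direction.\<close>

lemma monoidal_rule_coextend:
  assumes "monoidal_rule X d" and [simp]: "A \<in> Obj X" "B \<in> Obj X"
    and "f \<in> hom X (!\<^sub>o A \<odot> !\<^sub>o B) C"
  shows "(\<one> (!\<^sub>o A) \<otimes> d B) \<Zsemi> coextend A B f
    = (copy_tensor A B \<otimes> \<one> B) \<Zsemi> (coextend A B f \<otimes> ((\<one> (!\<^sub>o A) \<otimes> d B) \<Zsemi> f)) \<Zsemi> d C"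
proof -
  have [simp]: "C \<in> Obj X"
    using assms by auto
  let ?A = "!\<^sub>o A" and ?B = "!\<^sub>o B"
  let ?mid = "\<one> (!\<^sub>o ?A) \<otimes> \<sigma> (!\<^sub>o ?A) (!\<^sub>o ?B) \<otimes> \<one> ?B"
  let ?end = "((\<mm> ?A ?B \<Zsemi> !\<^sub>a f) \<otimes> ((\<epsilon> ?A \<otimes> \<one> ?B) \<Zsemi> f)) \<Zsemi> d C"
  \<comment> \<open>The rule is used one level up, at \<open>!A\<close> and \<open>!B\<close>,
    because a coextension contains \<open>\<mm>\<close> there.\<close>
  have "(\<one> (!\<^sub>o ?A) \<otimes> d ?B) \<Zsemi> \<mm> ?A ?B
    = (\<Delta> ?A \<otimes> \<one> (!\<^sub>o ?B) \<otimes> \<one> ?B) \<Zsemi> ?mid \<Zsemi> (\<mm> ?A ?B \<otimes> \<epsilon> ?A \<otimes> \<one> ?B) \<Zsemi> d (?A \<odot> ?B)"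
    using assms(1) by (simp add: monoidal_rule_def)
  then have "(\<one> (!\<^sub>o ?A) \<otimes> d ?B) \<Zsemi> (\<mm> ?A ?B \<Zsemi> !\<^sub>a f)
    = ((\<Delta> ?A \<otimes> \<one> (!\<^sub>o ?B) \<otimes> \<one> ?B) \<Zsemi> ?mid \<Zsemi> (\<mm> ?A ?B \<otimes> \<epsilon> ?A \<otimes> \<one> ?B) \<Zsemi> d (?A \<odot> ?B)) \<Zsemi> !\<^sub>a f"
    by (rule comp_extend) (use assms(4) in simp_all)
  also have "\<dots> = (\<Delta> ?A \<otimes> \<one> (!\<^sub>o ?B) \<otimes> \<one> ?B) \<Zsemi> ?mid
      \<Zsemi> ((\<mm> ?A ?B \<otimes> \<epsilon> ?A \<otimes> \<one> ?B) \<Zsemi> (d (?A \<odot> ?B) \<Zsemi> !\<^sub>a f))"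
    using assms(4) by simp
  \<comment> \<open>Naturality of \<open>d\<close> at \<open>f\<close> moves \<open>!f\<close> in
    front of \<open>d\<close>, so that \<open>f\<close> also acts on the direction.\<close>
  also have "(\<mm> ?A ?B \<otimes> \<epsilon> ?A \<otimes> \<one> ?B) \<Zsemi> (d (?A \<odot> ?B) \<Zsemi> !\<^sub>a f) = ?end"
    unfolding deriving_bang[OF assms(4), symmetric] using assms(4) by (simp add: interchange_extend)
  finally have rule: "(\<one> (!\<^sub>o ?A) \<otimes> d ?B) \<Zsemi> (\<mm> ?A ?B \<Zsemi> !\<^sub>a f)
    = (\<Delta> ?A \<otimes> \<one> (!\<^sub>o ?B) \<otimes> \<one> ?B) \<Zsemi> ?mid \<Zsemi> ?end" .
  \<comment> \<open>The chain rule rewrites \<open>d B \<Zsemi> \<delta> B\<close>, exposing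
    \<open>d\<close> at \<open>!B\<close> for the instance above.\<close>
  have "(\<one> ?A \<otimes> d B) \<Zsemi> coextend A B f
    = (\<delta> A \<otimes> ((\<Delta> B \<otimes> \<one> B) \<Zsemi> (\<delta> B \<otimes> d B))) \<Zsemi> ((\<one> (!\<^sub>o ?A) \<otimes> d ?B) \<Zsemi> (\<mm> ?A ?B \<Zsemi> !\<^sub>a f))"
    using assms by (simp add: coextend_def interchange_extend deriving_comult)
  also have "\<dots> = ((\<delta> A \<Zsemi> \<Delta> ?A) \<otimes> ((\<Delta> B \<otimes> \<one> B) \<Zsemi> (\<delta> B \<otimes> d B))) \<Zsemi> ?mid \<Zsemi> ?end"
    using assms by (simp add: rule interchange_extend)
  also have "\<dots> = (\<Delta> A \<otimes> \<Delta> B \<otimes> \<one> B) \<Zsemi> (((\<delta> A \<otimes> \<delta> A) \<otimes> (\<delta> B \<otimes> d B)) \<Zsemi> ?mid) \<Zsemi> ?end"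
    using assms by (simp add: comult_copy interchange_extend del: tensor_assoc)
  \<comment> \<open>The second copy of \<open>!B\<close> enters \<open>d B\<close> together with its
    direction, so the last factor crossing the shuffle is \<open>?B \<odot> B\<close>.\<close>
  also have "((\<delta> A \<otimes> \<delta> A) \<otimes> (\<delta> B \<otimes> d B)) \<Zsemi> ?mid
    = (\<one> ?A \<otimes> \<sigma> ?A ?B \<otimes> \<one> ?B \<otimes> \<one> B) \<Zsemi> ((\<delta> A \<otimes> \<delta> B) \<otimes> (\<delta> A \<otimes> d B))"
    using middle_interchange[of "\<delta> A" ?A "!\<^sub>o ?A" "\<delta> A" ?A "!\<^sub>o ?A" "\<delta> B" ?B "!\<^sub>o ?B" "d B" "?B \<odot> B" ?B]
    by simp
  also have "(\<Delta> A \<otimes> \<Delta> B \<otimes> \<one> B) \<Zsemi> \<dots> \<Zsemi> ?end =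
    ((\<Delta> A \<otimes> \<Delta> B \<otimes> \<one> B) \<Zsemi> (\<one> ?A \<otimes> \<sigma> ?A ?B \<otimes> \<one> ?B \<otimes> \<one> B))
      \<Zsemi> (((\<delta> A \<otimes> \<delta> B) \<otimes> (\<delta> A \<otimes> d B)) \<Zsemi> ?end)"
    using assms by simp
  also have "(\<Delta> A \<otimes> \<Delta> B \<otimes> \<one> B) \<Zsemi> (\<one> ?A \<otimes> \<sigma> ?A ?B \<otimes> \<one> ?B \<otimes> \<one> B) = copy_tensor A B \<otimes> \<one> B"
    using interchange[of "\<Delta> A \<otimes> \<Delta> B" "\<one> ?A \<otimes> \<sigma> ?A ?B \<otimes> \<one> ?B" "\<one> B" "\<one> B"]
    by (simp add: copy_tensor_def)
  \<comment> \<open>On the direction side \<open>\<delta> A\<close> cancels against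
    \<open>\<epsilon>\<close>; the other side is again a coextension.\<close>
  also have "((\<delta> A \<otimes> \<delta> B) \<otimes> (\<delta> A \<otimes> d B)) \<Zsemi> ?end
    = (coextend A B f \<otimes> ((\<one> ?A \<otimes> d B) \<Zsemi> f)) \<Zsemi> d C"
    using assms by (simp add: coextend_def interchange_extend comult_counit del: tensor_assoc)
  finally show ?thesis using assms by simp
qed

text \<open>\<open>\<nabla>\<close> is the coextension of \<open>s\<close>, so the rule for
  coextensions applies; the derivative of \<open>s\<close> in its second argument is the bare
  direction.\<close>

lemma monoidal_imp_nabla:
  assumes "monoidal_rule X d"
  shows "nabla_rule X d"
  unfolding nabla_rule_def
proof
  fix A assume [simp]: "A \<in> Obj X"
  define s where "s = \<epsilon> A \<otimes> \<ee> A \<oplus> \<ee> A \<otimes> \<epsilon> A"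
  have [simp]: "s \<in> Arr X" "Dom X s = !\<^sub>o A \<odot> !\<^sub>o A" "Cod X s = A"
    by (simp_all add: s_def)
  have nabla: "\<nabla> A = coextend A A s"
    by (simp add: nabla_def coextend_def s_def)
  \<comment> \<open>The constant rule annihilates the first summand of \<open>s\<close>, and the
    linear rule evaluates the second.\<close>
  have "(\<one> (!\<^sub>o A) \<otimes> d A) \<Zsemi> s = \<ee> A \<otimes> \<ee> A \<otimes> \<one> A"
    by (simp add: s_def distribs interchange deriving_discard deriving_counit)
  then have "(\<one> (!\<^sub>o A) \<otimes> d A) \<Zsemi> \<nabla> A
    = ((copy_tensor A A \<otimes> \<one> A) \<Zsemi> ((\<nabla> A \<otimes> \<ee> A \<otimes> \<ee> A) \<otimes> \<one> A)) \<Zsemi> d A"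
    using monoidal_rule_coextend[OF assms, of A A s A] by (simp add: nabla)
  \<comment> \<open>The second copies of both factors are discarded, which undoes the
    copying.\<close>
  also have "(copy_tensor A A \<otimes> \<one> A) \<Zsemi> ((\<nabla> A \<otimes> \<ee> A \<otimes> \<ee> A) \<otimes> \<one> A) = \<nabla> A \<otimes> \<one> A"
    using copy_tensor_discard_comp[of A A s] copy_tensor_discard_comp[of A A "coextend A A s"]
    by (simp add: interchange nabla del: tensor_assoc)
  finally show "(\<nabla> A \<otimes> \<one> A) \<Zsemi> d A = (\<one> (!\<^sub>o A) \<otimes> d A) \<Zsemi> \<nabla> A"
    by simp
qed

end

section \<open>The pivot identity between \<open>d\<close> and \<open>join\<close>\<close>

locale deriving_weak_biproduct = deriving X d + weak_biproduct X A B W i0 i1 p0 p1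
  for X :: "('o, 'a, 'x) additive_linear_category_scheme" (structure) and d A B W i0 i1 p0 p1
begin

lemma nabla_imp_join:
  assumes "nabla_rule X d"
  shows "(join \<otimes> i1) \<Zsemi> d W = (\<one> (!\<^sub>o A) \<otimes> d B) \<Zsemi> join"
proof -
  have [simp]: "\<nabla> W \<in> Arr X" "Dom X (\<nabla> W) = !\<^sub>o W \<odot> !\<^sub>o W" "Cod X (\<nabla> W) = !\<^sub>o W"
    by (simp_all add: nabla_def)
  have "(join \<otimes> i1) \<Zsemi> d W = ((!\<^sub>a i0 \<otimes> !\<^sub>a i1) \<otimes> i1) \<Zsemi> ((\<nabla> W \<otimes> \<one> W) \<Zsemi> d W)"
    by (simp add: join_nabla interchange_extend del: tensor_assoc)
  also have "\<dots> = (!\<^sub>a i0 \<otimes> (!\<^sub>a i1 \<otimes> i1)) \<Zsemi> ((\<one> (!\<^sub>o W) \<otimes> d W) \<Zsemi> \<nabla> W)"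
    using assms by (simp add: nabla_rule_def)
  also have "\<dots> = (!\<^sub>a i0 \<otimes> (d B \<Zsemi> !\<^sub>a i1)) \<Zsemi> \<nabla> W"
    using deriving_bang[of i1 B W] by (simp add: interchange_extend)
  also have "\<dots> = (\<one> (!\<^sub>o A) \<otimes> d B) \<Zsemi> ((!\<^sub>a i0 \<otimes> !\<^sub>a i1) \<Zsemi> \<nabla> W)"
    by (simp add: interchange_extend)
  finally show ?thesis
    by (simp add: join_nabla)
qed

text \<open>Each Leibniz term differentiates one of the two copies; naturality of \<open>d\<close>
  at \<open>p1\<close> or \<open>p0\<close> then pushes that projection into both the point and the
  direction.\<close>

lemma leibniz_split:
  assumes "leibniz_rule X d"
  shows "d W \<Zsemi> split = (split \<otimes> p1) \<Zsemi> (\<one> (!\<^sub>o A) \<otimes> d B)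
    \<oplus> (split \<otimes> p0) \<Zsemi> (\<one> (!\<^sub>o A) \<otimes> \<sigma> (!\<^sub>o B) A) \<Zsemi> (d A \<otimes> \<one> (!\<^sub>o B))"
proof -
  have "(\<one> (!\<^sub>o W) \<otimes> d W) \<Zsemi> (!\<^sub>a p0 \<otimes> !\<^sub>a p1) = ((!\<^sub>a p0 \<otimes> !\<^sub>a p1) \<otimes> p1) \<Zsemi> (\<one> (!\<^sub>o A) \<otimes> d B)"
    using deriving_bang[of p1 W B] by (simp add: interchange)
  then have left: "(\<Delta> W \<otimes> \<one> W) \<Zsemi> ((\<one> (!\<^sub>o W) \<otimes> d W) \<Zsemi> (!\<^sub>a p0 \<otimes> !\<^sub>a p1))
    = (split \<otimes> p1) \<Zsemi> (\<one> (!\<^sub>o A) \<otimes> d B)"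
    by (simp add: split_def interchange_extend del: tensor_assoc)
  \<comment> \<open>In the second term the direction is carried past the other copy, so the
    projections must cross a symmetry.\<close>
  have "(\<one> (!\<^sub>o W) \<otimes> \<sigma> (!\<^sub>o W) W) \<Zsemi> ((d W \<otimes> \<one> (!\<^sub>o W)) \<Zsemi> (!\<^sub>a p0 \<otimes> !\<^sub>a p1))
    = (\<one> (!\<^sub>o W) \<otimes> \<sigma> (!\<^sub>o W) W) \<Zsemi> ((!\<^sub>a p0 \<otimes> (p0 \<otimes> !\<^sub>a p1)) \<Zsemi> (d A \<otimes> \<one> (!\<^sub>o B)))"
    using deriving_bang[of p0 W A] interchange[of "!\<^sub>a p0 \<otimes> p0" "d A" "!\<^sub>a p1" "\<one> (!\<^sub>o B)"]
    by (simp add: interchange)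
  also have "\<dots> = (!\<^sub>a p0 \<otimes> (\<sigma> (!\<^sub>o W) W \<Zsemi> (p0 \<otimes> !\<^sub>a p1))) \<Zsemi> (d A \<otimes> \<one> (!\<^sub>o B))"
    by (simp add: interchange_extend)
  also have "\<dots> = ((!\<^sub>a p0 \<otimes> !\<^sub>a p1) \<otimes> p0) \<Zsemi> ((\<one> (!\<^sub>o A) \<otimes> \<sigma> (!\<^sub>o B) A) \<Zsemi> (d A \<otimes> \<one> (!\<^sub>o B)))"
    using symm_natural[of "!\<^sub>a p1" "!\<^sub>o W" "!\<^sub>o B" p0 W A] by (simp add: interchange_extend)
  finally have "(\<Delta> W \<otimes> \<one> W) \<Zsemi> ((\<one> (!\<^sub>o W) \<otimes> \<sigma> (!\<^sub>o W) W) \<Zsemi> ((d W \<otimes> \<one> (!\<^sub>o W)) \<Zsemi> (!\<^sub>a p0 \<otimes> !\<^sub>a p1)))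
    = (split \<otimes> p0) \<Zsemi> ((\<one> (!\<^sub>o A) \<otimes> \<sigma> (!\<^sub>o B) A) \<Zsemi> (d A \<otimes> \<one> (!\<^sub>o B)))"
    by (simp add: split_def interchange_extend del: tensor_assoc)
  moreover have "d W \<Zsemi> split = ((\<Delta> W \<otimes> \<one> W) \<Zsemi> ((\<one> (!\<^sub>o W) \<otimes> d W)
      \<oplus> (\<one> (!\<^sub>o W) \<otimes> \<sigma> (!\<^sub>o W) W) \<Zsemi> (d W \<otimes> \<one> (!\<^sub>o W)))) \<Zsemi> (!\<^sub>a p0 \<otimes> !\<^sub>a p1)"
    unfolding split_def
    by (rule comp_extend) (use assms in \<open>auto simp: leibniz_rule_def\<close>)
  ultimately show ?thesis
    using left by (simp add: distribs)
qed

lemma leibniz_imp_join: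
  assumes "leibniz_rule X d"
  shows "(join \<otimes> i1) \<Zsemi> d W = (\<one> (!\<^sub>o A) \<otimes> d B) \<Zsemi> join"
proof -
  \<comment> \<open>The term through \<open>p0\<close> vanishes because
    \<open>i1 \<Zsemi> p0\<close> is zero; in the other, \<open>join\<close> cancels
    \<open>split\<close>.\<close>
  have "(join \<otimes> i1) \<Zsemi> (d W \<Zsemi> split) = \<one> (!\<^sub>o A) \<otimes> d B"
    by (simp add: leibniz_split[OF assms] distribs interchange_extend)
  then have "(\<one> (!\<^sub>o A) \<otimes> d B) \<Zsemi> join = ((join \<otimes> i1) \<Zsemi> (d W \<Zsemi> split)) \<Zsemi> join"
    by (rule arg_cong[OF sym])
  also have "\<dots> = (join \<otimes> i1) \<Zsemi> (d W \<Zsemi> (split \<Zsemi> join))"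
    by simp
  \<comment> \<open>Naturality of \<open>d\<close> moves \<open>!idem\<close> in front, where
    \<open>join\<close> and \<open>i1\<close> absorb it.\<close>
  also have "\<dots> = (join \<otimes> i1) \<Zsemi> ((!\<^sub>a idem \<otimes> idem) \<Zsemi> d W)"
    using deriving_bang[of idem W W] by (simp add: split_join)
  also have "\<dots> = (join \<otimes> i1) \<Zsemi> d W"
    by (simp add: interchange_extend join_idem inj_idem)
  finally show ?thesis
    by simp
qed

lemma join_imp_monoidal:
  assumes "(join \<otimes> i1) \<Zsemi> d W = (\<one> (!\<^sub>o A) \<otimes> d B) \<Zsemi> join"
  shows "(\<one> (!\<^sub>o A) \<otimes> d B) \<Zsemi> \<mm> A B =
    (\<Delta> A \<otimes> \<one> (!\<^sub>o B) \<otimes> \<one> B) \<Zsemi> (\<one> (!\<^sub>o A) \<otimes> \<sigma> (!\<^sub>o A) (!\<^sub>o B) \<otimes> \<one> B) \<Zsemi>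
      (\<mm> A B \<otimes> \<epsilon> A \<otimes> \<one> B) \<Zsemi> d (A \<odot> B)"
proof -
  \<comment> \<open>\<open>q\<close> is chosen so that \<open>join \<Zsemi> q\<close> is
    \<open>\<epsilon> \<otimes> \<epsilon>\<close>, the map whose coextension is
    \<open>\<mm>\<close>; thus \<open>\<mm>\<close> factors through \<open>join\<close>.\<close>
  define q where "q = split \<Zsemi> (\<epsilon> A \<otimes> \<epsilon> B)"
  have q [simp]: "q \<in> Arr X" "Dom X q = !\<^sub>o W" "Cod X q = A \<odot> B"
    by (simp_all add: q_def)
  have "join \<Zsemi> \<delta> W \<Zsemi> !\<^sub>a q = coextend A B (join \<Zsemi> q)"
    using coextend_comult[of A B injection W] coextend_bang[of A B join "!\<^sub>o W" q "A \<odot> B"]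
    by (simp only: join_def) simp
  then have m: "\<mm> A B = join \<Zsemi> (\<delta> W \<Zsemi> !\<^sub>a q)"
    by (simp add: q_def coextend_counit_discard)
  have "(join \<otimes> i1) \<Zsemi> (d W \<Zsemi> q) = (\<one> (!\<^sub>o A) \<otimes> d B) \<Zsemi> (join \<Zsemi> q)"
    by (subst comp_extend[OF assms]) simp_all
  then have jq: "(join \<otimes> i1) \<Zsemi> (d W \<Zsemi> q) = \<epsilon> A \<otimes> \<ee> B \<otimes> \<one> B"
    by (simp add: q_def interchange deriving_counit)
  have "(\<one> (!\<^sub>o A) \<otimes> d B) \<Zsemi> \<mm> A B = (join \<otimes> i1) \<Zsemi> ((d W \<Zsemi> \<delta> W) \<Zsemi> !\<^sub>a q)"
    unfolding m by (subst comp_extend[OF assms[symmetric]]) simp_all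
  \<comment> \<open>The chain rule, followed by naturality of \<open>d\<close> at
    \<open>q\<close>.\<close>
  also have "\<dots> = (join \<otimes> i1) \<Zsemi> ((\<Delta> W \<otimes> \<one> W) \<Zsemi> (((\<delta> W \<Zsemi> !\<^sub>a q) \<otimes> (d W \<Zsemi> q)) \<Zsemi> d (A \<odot> B)))"
    using deriving_bang[of q "!\<^sub>o W" "A \<odot> B", symmetric] by (simp add: deriving_comult interchange_extend)
  also have "\<dots> = ((copy_tensor A B \<Zsemi> (join \<otimes> join)) \<otimes> i1)
      \<Zsemi> (((\<delta> W \<Zsemi> !\<^sub>a q) \<otimes> (d W \<Zsemi> q)) \<Zsemi> d (A \<odot> B))"
    by (simp add: join_copy interchange_extend)
  also have "\<dots> = (copy_tensor A B \<otimes> \<one> B) \<Zsemi> ((join \<otimes> (join \<otimes> i1))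
      \<Zsemi> (((\<delta> W \<Zsemi> !\<^sub>a q) \<otimes> (d W \<Zsemi> q)) \<Zsemi> d (A \<odot> B)))"
    using comp_extend[OF interchange, of "copy_tensor A B" "join \<otimes> join" "\<one> B" i1
        "((\<delta> W \<Zsemi> !\<^sub>a q) \<otimes> (d W \<Zsemi> q)) \<Zsemi> d (A \<odot> B)"] by simp
  also have "\<dots> = (copy_tensor A B \<otimes> \<one> B) \<Zsemi> ((\<mm> A B \<otimes> (\<epsilon> A \<otimes> \<ee> B \<otimes> \<one> B)) \<Zsemi> d (A \<odot> B))"
    by (simp add: interchange_extend jq flip: m)
  \<comment> \<open>Factoring out the discard of the second copy of \<open>!B\<close> lets it cancel
    against the copying of \<open>!B\<close>, so that only \<open>!A\<close> is copied.\<close>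
  also have "\<mm> A B \<otimes> (\<epsilon> A \<otimes> \<ee> B \<otimes> \<one> B)
    = (\<one> (!\<^sub>o A \<odot> !\<^sub>o B) \<otimes> \<one> (!\<^sub>o A) \<otimes> \<ee> B \<otimes> \<one> B) \<Zsemi> (\<mm> A B \<otimes> \<epsilon> A \<otimes> \<one> B)"
    by (simp add: interchange)
  also have "(copy_tensor A B \<otimes> \<one> B) \<Zsemi> (\<dots> \<Zsemi> d (A \<odot> B))
    = ((copy_tensor A B \<otimes> \<one> B) \<Zsemi> (\<one> (!\<^sub>o A \<odot> !\<^sub>o B) \<otimes> \<one> (!\<^sub>o A) \<otimes> \<ee> B \<otimes> \<one> B))
      \<Zsemi> ((\<mm> A B \<otimes> \<epsilon> A \<otimes> \<one> B) \<Zsemi> d (A \<odot> B))"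
    by simp
  also have "(copy_tensor A B \<otimes> \<one> B) \<Zsemi> (\<one> (!\<^sub>o A \<odot> !\<^sub>o B) \<otimes> \<one> (!\<^sub>o A) \<otimes> \<ee> B \<otimes> \<one> B)
    = ((\<Delta> A \<otimes> \<one> (!\<^sub>o B)) \<Zsemi> (\<one> (!\<^sub>o A) \<otimes> \<sigma> (!\<^sub>o A) (!\<^sub>o B))) \<otimes> (\<one> B \<Zsemi> \<one> B)"
    using interchange[of "copy_tensor A B" "\<one> (!\<^sub>o A \<odot> !\<^sub>o B) \<otimes> \<one> (!\<^sub>o A) \<otimes> \<ee> B" "\<one> B" "\<one> B"]
    by (simp add: copy_tensor_discard)
  also have "\<dots> = (\<Delta> A \<otimes> \<one> (!\<^sub>o B) \<otimes> \<one> B) \<Zsemi> (\<one> (!\<^sub>o A) \<otimes> \<sigma> (!\<^sub>o A) (!\<^sub>o B) \<otimes> \<one> B)"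
    by (subst interchange[symmetric]) (simp_all del: tensor_ident)
  finally show ?thesis
    by simp
qed

end

section \<open>Closing the cycle of implications with concrete formal retracts\<close>

context deriving
begin

lemma leibniz_imp_monoidal:
  assumes "leibniz_rule X d"
  shows "monoidal_rule X d"
  unfolding monoidal_rule_def
proof (intro ballI)
  fix A B assume obj: "A \<in> Obj X" "B \<in> Obj X"
  interpret weak_biproduct X A B "!\<^sub>o A \<odot> !\<^sub>o B" "codereliction A \<otimes> induced_unit X B"
    "induced_unit X A \<otimes> codereliction B" "\<epsilon> A \<otimes> \<ee> B" "\<ee> A \<otimes> \<epsilon> B"
    by (rule weak_biproduct_tensor[OF obj])
  interpret deriving_weak_biproduct X d A B "!\<^sub>o A \<odot> !\<^sub>o B" "codereliction A \<otimes> induced_unit X B"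
    "induced_unit X A \<otimes> codereliction B" "\<epsilon> A \<otimes> \<ee> B" "\<ee> A \<otimes> \<epsilon> B" ..
  show "(\<one> (!\<^sub>o A) \<otimes> d B) \<Zsemi> \<mm> A B =
    (\<Delta> A \<otimes> \<one> (!\<^sub>o B) \<otimes> \<one> B) \<Zsemi> (\<one> (!\<^sub>o A) \<otimes> \<sigma> (!\<^sub>o A) (!\<^sub>o B) \<otimes> \<one> B) \<Zsemi>
      (\<mm> A B \<otimes> \<epsilon> A \<otimes> \<one> B) \<Zsemi> d (A \<odot> B)"
    by (rule join_imp_monoidal[OF leibniz_imp_join[OF assms]])
qed

text \<open>When \<open>\<Delta>\<close> is written as \<open>!(i0 \<oplus> i1)\<close> followed by
  \<open>split\<close>, naturality of \<open>d\<close> produces the direction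
  \<open>i0 \<oplus> i1\<close>; its two summands yield the two Leibniz terms.\<close>

lemma nabla_imp_leibniz:
  assumes "nabla_rule X d"
  shows "leibniz_rule X d"
  unfolding leibniz_rule_def
proof
  fix A assume obj [simp]: "A \<in> Obj X"
  define W i0 i1 p0 p1 where "W = !\<^sub>o A \<odot> !\<^sub>o A"
    and "i0 = codereliction A \<otimes> induced_unit X A" and "i1 = induced_unit X A \<otimes> codereliction A"
    and "p0 = \<epsilon> A \<otimes> \<ee> A" and "p1 = \<ee> A \<otimes> \<epsilon> A"
  interpret weak_biproduct X A A W i0 i1 p0 p1
    unfolding W_def i0_def i1_def p0_def p1_def by (rule weak_biproduct_tensor[OF obj obj])
  interpret deriving_weak_biproduct X d A A W i0 i1 p0 p1 ..
  \<comment> \<open>The pivot treats the direction \<open>i1\<close>; exchanging the two injections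
    provides it for \<open>i0\<close>.\<close>
  interpret swap: weak_biproduct X A A W i1 i0 p1 p0
    by unfold_locales simp_all
  interpret swap: deriving_weak_biproduct X d A A W i1 i0 p1 p0 ..
  have copy_join: "\<Delta> A \<Zsemi> join = !\<^sub>a (i0 \<oplus> i1)" "\<Delta> A \<Zsemi> swap.join = !\<^sub>a (i0 \<oplus> i1)"
    using copy_bang_join[of "\<one> A" A "\<one> A"] swap.copy_bang_join[of "\<one> A" A "\<one> A"]
      add_commute[of i0 A W i1] by simp_all
  \<comment> \<open>Cocommutativity relates the two splittings by a symmetry, so
    \<open>swap.join\<close> followed by \<open>split\<close> is a pure swap.\<close>
  have "split = swap.split \<Zsemi> \<sigma> (!\<^sub>o A) (!\<^sub>o A)"
    using symm_natural[of "!\<^sub>a p1" "!\<^sub>o W" "!\<^sub>o A" "!\<^sub>a p0" "!\<^sub>o W" "!\<^sub>o A"]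
      comp_extend[OF copy_symm, of W "!\<^sub>a p0 \<otimes> !\<^sub>a p1"]
    by (simp add: split_def swap.split_def)
  then have swap_join_split: "swap.join \<Zsemi> split = \<sigma> (!\<^sub>o A) (!\<^sub>o A)"
    by simp
  \<comment> \<open>By \<open>copy_join\<close> the sum \<open>!(i0 \<oplus> i1)\<close> is
    \<open>\<Delta> A \<Zsemi> join\<close>, and \<open>join\<close> cancels
    \<open>split\<close>.\<close>
  have "d A \<Zsemi> \<Delta> A = d A \<Zsemi> (!\<^sub>a (i0 \<oplus> i1) \<Zsemi> split)"
    by (simp flip: copy_join(1))
  also have "\<dots> = (!\<^sub>a (i0 \<oplus> i1) \<otimes> (i0 \<oplus> i1)) \<Zsemi> (d W \<Zsemi> split)"
    using comp_extend[OF deriving_bang[of "i0 \<oplus> i1" A W], of split] by simp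
  also have "\<dots> = (!\<^sub>a (i0 \<oplus> i1) \<otimes> i0) \<Zsemi> (d W \<Zsemi> split) \<oplus> (!\<^sub>a (i0 \<oplus> i1) \<otimes> i1) \<Zsemi> (d W \<Zsemi> split)"
    by (simp add: distribs)
  also have "(!\<^sub>a (i0 \<oplus> i1) \<otimes> i0) \<Zsemi> (d W \<Zsemi> split)
    = (\<Delta> A \<otimes> \<one> A) \<Zsemi> (((swap.join \<otimes> i0) \<Zsemi> d W) \<Zsemi> split)"
    by (simp add: interchange_extend copy_join)
  also have "\<dots> = (\<Delta> A \<otimes> \<one> A) \<Zsemi> ((\<one> (!\<^sub>o A) \<otimes> d A) \<Zsemi> \<sigma> (!\<^sub>o A) (!\<^sub>o A))"
    by (simp add: swap.nabla_imp_join[OF assms] swap_join_split)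
  also have "\<dots> = (\<Delta> A \<otimes> \<one> A) \<Zsemi> (\<sigma> (!\<^sub>o A) (!\<^sub>o A \<odot> A) \<Zsemi> (d A \<otimes> \<one> (!\<^sub>o A)))"
    using symm_natural[of "\<one> (!\<^sub>o A)" "!\<^sub>o A" "!\<^sub>o A" "d A" "!\<^sub>o A \<odot> A" "!\<^sub>o A"] by simp
  \<comment> \<open>The hexagon decomposes the symmetry past \<open>!A \<otimes> A\<close>; its
    first part is later absorbed by cocommutativity.\<close>
  also have "\<dots> = ((\<Delta> A \<Zsemi> \<sigma> (!\<^sub>o A) (!\<^sub>o A)) \<otimes> \<one> A)
      \<Zsemi> ((\<one> (!\<^sub>o A) \<otimes> \<sigma> (!\<^sub>o A) A) \<Zsemi> (d A \<otimes> \<one> (!\<^sub>o A)))"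
    by (simp add: symm_hexagon interchange_extend)
  also have "(!\<^sub>a (i0 \<oplus> i1) \<otimes> i1) \<Zsemi> (d W \<Zsemi> split)
    = (\<Delta> A \<otimes> \<one> A) \<Zsemi> (((join \<otimes> i1) \<Zsemi> d W) \<Zsemi> split)"
    by (simp add: interchange_extend copy_join)
  also have "\<dots> = (\<Delta> A \<otimes> \<one> A) \<Zsemi> (\<one> (!\<^sub>o A) \<otimes> d A)"
    by (simp add: nabla_imp_join[OF assms])
  finally show "d A \<Zsemi> \<Delta> A = (\<Delta> A \<otimes> \<one> A) \<Zsemi>
      ((\<one> (!\<^sub>o A) \<otimes> d A) \<oplus> (\<one> (!\<^sub>o A) \<otimes> \<sigma> (!\<^sub>o A) A) \<Zsemi> (d A \<otimes> \<one> (!\<^sub>o A)))"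
    using add_commute[of "(\<Delta> A \<otimes> \<one> A) \<Zsemi> (\<one> (!\<^sub>o A) \<otimes> d A)" "!\<^sub>o A \<odot> A" "!\<^sub>o A \<odot> !\<^sub>o A"
        "(\<Delta> A \<otimes> \<one> A) \<Zsemi> ((\<one> (!\<^sub>o A) \<otimes> \<sigma> (!\<^sub>o A) A) \<Zsemi> (d A \<otimes> \<one> (!\<^sub>o A)))"]
    by (simp add: copy_symm distribs)
qed

end

theorem proposition6p10:
  fixes X :: "('o, 'a, 'x) additive_linear_category_scheme" and d :: "'o \<Rightarrow> 'a"
  assumes "additive_linear_category X"
    and "deriving_natural X d"
    and "linear_rule X d"
    and "chain_rule X d"
  shows "(leibniz_rule X d \<longleftrightarrow> nabla_rule X d) \<and> (nabla_rule X d \<longleftrightarrow> monoidal_rule X d)"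
proof -
  interpret deriving X d
    using assms by (simp add: deriving_def deriving_axioms_def)
  \<comment> \<open>The implications form a cycle: Leibniz to monoidal, monoidal to \<nabla>, and
    \<nabla> to Leibniz.\<close>
  show ?thesis
    using leibniz_imp_monoidal monoidal_imp_nabla nabla_imp_leibniz by blast
qed

end
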